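(* Let $\ell\in\{1,\dots,N\}$ and let $w_{h,\ell}\in V_{0,\ell}$. Then there exists a unique finite element function $\mathrm{imp}^h_{\Gamma_\ell}w_{h,\ell}\in V(\Gamma_\ell)$ such that $$\int_{\Gamma_\ell}\big(\mathrm{imp}^h_{\Gamma_\ell}w_{h,\ell}\big)\,\overline{v_{h,\ell}}=a_{\Omega_\ell}(w_{h,\ell},v_{h,\ell})\quad\text{for all }v_{h,\ell}\in V_\ell.$$
   Context: Setting. $\Omega\subset\mathbb R^d$ ($d=2,3$) is a bounded Lipschitz (polygonal/polyhedral) domain and $k>0$. $V\subset H^1(\Omega)$ is the nodal finite element space of (complex-valued) continuous piecewise polynomials of total degree $\le p$ on a conforming simplicial mesh $T^h$ of $\Omega$. $\{\Omega_j\}_{j=1}^N$ is an overlapping cover of $\Omega$ by Lipschitz polygonal/polyhedral subdomains whose boundaries are resolved by $T^h$. $V_\ell:=\{v_h|_{\overline{\Omega_\ell}}:v_h\in V\}$, $\Gamma_\ell:=\partial\Omega_\ell\setminus\partial\Omega$, and $V(\Gamma_\ell)$ is the space of restrictions to $\Gamma_\ell$ of functions in $V$. $a_{\Omega_\ell}(v,w):=\int_{\Omega_\ell}(\nabla v\cdot\overline{\nabla w}-k^2v\overline w)-\mathrm{i}k\int_{\partial\Omega_\ell}v\overline w$. $H^1_{0,\Gamma_\ell}(\Omega_\ell):=\{v\in H^1(\Omega_\ell):v=0\text{ on }\Gamma_\ell\}$. The discrete Helmholtz-harmonic space is $$V_{0,\ell}:=\{w_{h,\ell}\in V_\ell: a_{\Omega_\ell}(w_{h,\ell},v_{h,\ell})=0\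 \text{ for all }v_{h,\ell}\in V_\ell\cap H^1_{0,\Gamma_\ell}(\Omega_\ell)\}.$$ *)

theory Defs
  imports "HOL-Analysis.Analysis"
begin

section \<open>Surface measure\<close>

text \<open>
  Hausdorff measure, normalised so that on \<open>s\<close>-dimensional planes it is \<open>s\<close>-dimensional
  Lebesgue measure: a set of diameter \<open>D\<close> is weighted by the volume of the \<open>s\<close>-ball of
  diameter \<open>D\<close>. Unbounded covering sets are excluded because \<^const>\<open>diameter\<close> has no
  meaningful value on them, and the empty set must count \<open>0\<close> even for \<open>s = 0\<close>.
\<close>

definition hausdorff_weight :: "nat \<Rightarrow> 'a::metric_space set \<Rightarrow> ennreal" where
  "hausdorff_weight s C =
     (if C = {} then 0 else ennreal (unit_ball_vol (real s) * (diameter C / 2) ^ s))"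

definition hausdorff_content :: "nat \<Rightarrow> real \<Rightarrow> 'a::metric_space set \<Rightarrow> ennreal" where
  "hausdorff_content s \<delta> A =
     Inf {(\<Sum>i. hausdorff_weight s (C i)) |C :: nat \<Rightarrow> 'a set.
            A \<subseteq> (\<Union>i. C i) \<and> (\<forall>i. bounded (C i) \<and> diameter (C i) \<le> \<delta>)}"

definition hausdorff_outer :: "nat \<Rightarrow> 'a::metric_space set \<Rightarrow> ennreal" where
  "hausdorff_outer s A = (SUP \<delta>\<in>{0<..}. hausdorff_content s \<delta> A)"

text \<open>The outer measure is metric, hence (Caratheodory) countably additive on Borel sets.\<close>

definition hausdorff_measure :: "nat \<Rightarrow> 'a::metric_space measure" where
  "hausdorff_measure s = measure_of UNIV (sets borel) (hausdorff_outer s)"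

definition surface_measure :: "'a::euclidean_space measure" where
  "surface_measure = hausdorff_measure (DIM('a) - 1)"


section \<open>Lipschitz polyhedral domains\<close>

text \<open>
  Near each boundary point the set is the part of a ball above the graph of a Lipschitz function
  \<open>\<gamma>\<close> on the hyperplane orthogonal to a unit vector \<open>e\<close>.
\<close>

definition lipschitz_boundary :: "'a::euclidean_space set \<Rightarrow> bool" where
  "lipschitz_boundary S \<longleftrightarrow>
     (\<forall>x\<in>frontier S. \<exists>e r L. \<exists>\<gamma> :: 'a \<Rightarrow> real.
        norm e = 1 \<and> r > 0 \<and> L-lipschitz_on {z. z \<bullet> e = 0} \<gamma> \<and>
        S \<inter> ball x r = {y \<in> ball x r. y \<bullet> e > \<gamma> (y - (y \<bullet> e) *\<^sub>R e)})"

definition lipschitz_polyhedral_domain :: "'a::euclidean_space set \<Rightarrow> bool" where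
  "lipschitz_polyhedral_domain S \<longleftrightarrow>
     open S \<and> connected S \<and> S \<noteq> {} \<and> bounded S \<and> lipschitz_boundary S \<and>
     (\<exists>F. finite F \<and> (\<forall>P\<in>F. polytope P \<and> aff_dim P = int DIM('a) - 1) \<and> frontier S = \<Union>F)"


section \<open>Sobolev spaces\<close>

definition square_integrable :: "'a measure \<Rightarrow> 'a set \<Rightarrow> ('a \<Rightarrow> complex) \<Rightarrow> bool" where
  "square_integrable M A u \<longleftrightarrow>
     set_borel_measurable M A u \<and> set_integrable M A (\<lambda>x. (norm (u x))\<^sup>2)"

text \<open>
  Test functions are the compactly supported \<open>C\<^sup>1\<close> functions; by mollification they give the same
  weak derivatives as the smooth ones.
\<close>

definition test_function ::
  "'a::euclidean_space set \<Rightarrow> ('a \<Rightarrow> real) \<Rightarrow> ('a \<Rightarrow> 'a \<Rightarrow>\<^sub>L real) \<Rightarrow> bool" where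
  "test_function S \<phi> \<phi>' \<longleftrightarrow>
     (\<forall>x. (\<phi> has_derivative blinfun_apply (\<phi>' x)) (at x)) \<and> continuous_on UNIV \<phi>' \<and>
     (\<exists>K. compact K \<and> K \<subseteq> S \<and> (\<forall>x. x \<notin> K \<longrightarrow> \<phi> x = 0))"

definition locally_integrable :: "'a::euclidean_space set \<Rightarrow> ('a \<Rightarrow> complex) \<Rightarrow> bool" where
  "locally_integrable S u \<longleftrightarrow> (\<forall>K. compact K \<and> K \<subseteq> S \<longrightarrow> u absolutely_integrable_on K)"

definition has_weak_pderiv ::
  "'a::euclidean_space set \<Rightarrow> 'a \<Rightarrow> ('a \<Rightarrow> complex) \<Rightarrow> ('a \<Rightarrow> complex) \<Rightarrow> bool" where
  "has_weak_pderiv S b u g \<longleftrightarrow>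
     locally_integrable S u \<and> locally_integrable S g \<and>
     (\<forall>\<phi> \<phi>'. test_function S \<phi> \<phi>' \<longrightarrow>
        (LINT x:S|lebesgue. u x * of_real (blinfun_apply (\<phi>' x) b)) =
        - (LINT x:S|lebesgue. g x * of_real (\<phi> x)))"

text \<open>A representative of the weak derivative, which is unique up to null sets.\<close>

definition weak_pderiv ::
  "'a::euclidean_space set \<Rightarrow> 'a \<Rightarrow> ('a \<Rightarrow> complex) \<Rightarrow> 'a \<Rightarrow> complex" where
  "weak_pderiv S b u = (SOME g. has_weak_pderiv S b u g)"

definition H1 :: "'a::euclidean_space set \<Rightarrow> ('a \<Rightarrow> complex) set" where
  "H1 S = {u. square_integrable lebesgue S u \<and>
              (\<forall>b\<in>Basis. \<exists>g. square_integrable lebesgue S g \<and> has_weak_pderiv S b u g)}"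

definition H1_norm_sq :: "'a::euclidean_space set \<Rightarrow> ('a \<Rightarrow> complex) \<Rightarrow> real" where
  "H1_norm_sq S u =
     (LINT x:S|lebesgue. (norm (u x))\<^sup>2 + (\<Sum>b\<in>Basis. (norm (weak_pderiv S b u x))\<^sup>2))"

text \<open>
  The trace operator is the continuous extension to \<open>H\<^sup>1\<close> (with values in \<open>L\<^sup>2\<close> of the boundary)
  of the restriction of functions continuous up to the boundary.
\<close>

definition has_trace ::
  "'a::euclidean_space set \<Rightarrow> ('a \<Rightarrow> complex) \<Rightarrow> ('a \<Rightarrow> complex) \<Rightarrow> bool" where
  "has_trace S u g \<longleftrightarrow>
     square_integrable surface_measure (frontier S) g \<and>
     (\<exists>\<phi> :: nat \<Rightarrow> 'a \<Rightarrow> complex.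
        (\<forall>n. \<phi> n \<in> H1 S \<and> continuous_on (closure S) (\<phi> n)) \<and>
        (\<lambda>n. H1_norm_sq S (\<lambda>x. \<phi> n x - u x)) \<longlonglongrightarrow> 0 \<and>
        (\<lambda>n. LINT x:frontier S|surface_measure. (norm (\<phi> n x - g x))\<^sup>2) \<longlonglongrightarrow> 0)"

definition H1_zero_on ::
  "'a::euclidean_space set \<Rightarrow> 'a set \<Rightarrow> ('a \<Rightarrow> complex) set" where
  "H1_zero_on S \<Gamma> =
     {u \<in> H1 S. \<exists>g. has_trace S u g \<and> (AE x in surface_measure. x \<in> \<Gamma> \<longrightarrow> g x = 0)}"


section \<open>Finite element spaces\<close>

definition conforming_simplicial_mesh ::
  "'a::euclidean_space set set \<Rightarrow> 'a set \<Rightarrow> bool" where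
  "conforming_simplicial_mesh T \<Omega> \<longleftrightarrow>
     triangulation T \<and> (\<forall>K\<in>T. int DIM('a) simplex K) \<and> \<Union>T = closure \<Omega>"

definition boundary_resolved_by ::
  "'a::euclidean_space set \<Rightarrow> 'a set set \<Rightarrow> bool" where
  "boundary_resolved_by S T \<longleftrightarrow>
     (\<exists>\<F>. (\<forall>F\<in>\<F>. \<exists>K\<in>T. F facet_of K) \<and> frontier S = \<Union>\<F>)"

text \<open>Polynomial functions of total degree at most \<open>p\<close>, with multi-indices \<open>\<alpha>\<close> on the basis.\<close>

definition poly_total_degree_le :: "nat \<Rightarrow> ('a::euclidean_space \<Rightarrow> complex) \<Rightarrow> bool" where
  "poly_total_degree_le p P \<longleftrightarrow>
     (\<exists>c :: ('a \<Rightarrow> nat) \<Rightarrow> complex. \<forall>x.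
        P x = (\<Sum>\<alpha> \<in> {\<alpha> \<in> Basis \<rightarrow>\<^sub>E {..p}. (\<Sum>b\<in>Basis. \<alpha> b) \<le> p}.
                 c \<alpha> * of_real (\<Prod>b\<in>Basis. (x \<bullet> b) ^ \<alpha> b)))"

text \<open>
  A function on a set \<open>A\<close> is represented by its extension by zero, so that functions on \<open>A\<close> are
  equal iff their representatives are.
\<close>

definition restrict_zero :: "'a set \<Rightarrow> ('a \<Rightarrow> complex) \<Rightarrow> 'a \<Rightarrow> complex" where
  "restrict_zero A v = (\<lambda>x. if x \<in> A then v x else 0)"

definition FE_space ::
  "'a::euclidean_space set \<Rightarrow> 'a set set \<Rightarrow> nat \<Rightarrow> ('a \<Rightarrow> complex) set" where
  "FE_space \<Omega> T p =
     {v. continuous_on (closure \<Omega>) v \<and>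
         (\<forall>K\<in>T. \<exists>P. poly_total_degree_le p P \<and> (\<forall>x\<in>K. v x = P x)) \<and>
         (\<forall>x. x \<notin> closure \<Omega> \<longrightarrow> v x = 0)}"

definition FE_local ::
  "'a::euclidean_space set \<Rightarrow> 'a set set \<Rightarrow> nat \<Rightarrow> 'a set \<Rightarrow> ('a \<Rightarrow> complex) set" where
  "FE_local \<Omega> T p S = restrict_zero (closure S) ` FE_space \<Omega> T p"

definition interface :: "'a::euclidean_space set \<Rightarrow> 'a set \<Rightarrow> 'a set" where
  "interface \<Omega> S = frontier S - frontier \<Omega>"

definition FE_interface ::
  "'a::euclidean_space set \<Rightarrow> 'a set set \<Rightarrow> nat \<Rightarrow> 'a set \<Rightarrow> ('a \<Rightarrow> complex) set" where
  "FE_interface \<Omega> T p S = restrict_zero (interface \<Omega> S) ` FE_space \<Omega> T p"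


section \<open>The Helmholtz form and discrete Helmholtz-harmonic functions\<close>

text \<open>
  The boundary term uses point values, so the form is meant for arguments in \<open>H\<^sup>1\<close> that are
  continuous up to the boundary, such as finite element functions.
\<close>

definition helmholtz_form ::
  "'a::euclidean_space set \<Rightarrow> real \<Rightarrow> ('a \<Rightarrow> complex) \<Rightarrow> ('a \<Rightarrow> complex) \<Rightarrow> complex" where
  "helmholtz_form S k v w =
     (LINT x:S|lebesgue.
        (\<Sum>b\<in>Basis. weak_pderiv S b v x * cnj (weak_pderiv S b w x))
        - (of_real k)\<^sup>2 * v x * cnj (w x))
     - \<i> * of_real k * (LINT x:frontier S|surface_measure. v x * cnj (w x))"

definition discrete_harmonic ::
  "'a::euclidean_space set \<Rightarrow> 'a set set \<Rightarrow> nat \<Rightarrow> real \<Rightarrow> 'a set \<Rightarrow> ('a \<Rightarrow> complex) set" where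
  "discrete_harmonic \<Omega> T p k S =
     {w \<in> FE_local \<Omega> T p S.
        \<forall>v \<in> FE_local \<Omega> T p S \<inter> H1_zero_on S (interface \<Omega> S). helmholtz_form S k w v = 0}"

end

theory Submission
  imports Defs
begin

text \<open>
  Let \<open>V\<close> be the space of finite element functions on the subdomain \<open>S\<close>, \<open>\<Gamma>\<close> its interface, \<open>a\<close> the
  Helmholtz form and \<open>w\<close> discrete harmonic. If \<open>v \<in> V\<close> vanishes on \<open>\<Gamma>\<close>, then \<open>v\<close> is one of the
  functions against which harmonicity is tested, so \<open>a(w, v) = 0\<close>. Since \<open>v \<mapsto> a(w, v)\<close> is antilinear,
  it depends only on the values of \<open>v\<close> on \<open>\<Gamma>\<close>, that is, it is a functional on the finite-dimensional
  space of traces on \<open>\<Gamma>\<close>. The \<open>L\<^sup>2\<close> inner product of \<open>\<Gamma>\<close> is definite on that space, so the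
  functional has exactly one representer (\<open>riesz_representation_finite_span\<close> for existence,
  \<open>interface_inner_cancel\<close> for uniqueness).

  Three facts of analysis stand behind this.

  \<^item> Surface measure is a Borel measure that is finite on the boundary of a polyhedral domain and
  positive on each nonempty relatively open part of it (\<open>measure_space_hausdorff_outer\<close>,
  \<open>surface_measure_frontier_finite\<close>, \<open>surface_measure_frontier_ball_pos\<close>). Finiteness makes all
  boundary integrals of continuous functions exist, and positivity gives definiteness.

  \<^item> Weak derivatives are unique up to null sets (\<open>weak_pderiv_unique\<close>). As the form is written with
  arbitrarily chosen weak derivatives, its antilinearity rests on this.

  \<^item> A function that is continuous and piecewise polynomial on a mesh has bounded weak
  derivatives, namely the piecewise ones (\<open>piecewise_has_weak_pderiv\<close>). Hence finite element
  functions lie in \<open>H\<^sup>1\<close>, the form is an honest integral on them, and, being continuous, they are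
  their own traces.
\<close>

section \<open>Metric outer measures\<close>

text \<open>
  Caratheodory's criterion. The part of \<open>X\<close> at distance at least \<open>1/(n+1)\<close> from \<open>C\<close> is separated
  from \<open>C\<close>, so \<open>f\<close> adds up on the two. What is missing from \<open>X - C\<close> is a union of thin rings around
  \<open>C\<close>. Rings of equal parity are pairwise separated, hence their values are summable and the
  missing part becomes negligible as \<open>n\<close> grows.
\<close>

lemma metric_outer_measure_closed_additive:
  fixes f :: "'a::metric_space set \<Rightarrow> ennreal"
  assumes empty: "f {} = 0"
    and mono: "\<And>A B. A \<subseteq> B \<Longrightarrow> f A \<le> f B"
    and subadd: "\<And>A. f (\<Union>i. A i) \<le> (\<Sum>i::nat. f (A i))"
    and metric: "\<And>A B e. e > 0 \<Longrightarrow> (\<And>x y. x \<in> A \<Longrightarrow> y \<in> B \<Longrightarrow> e \<le> dist x y) \<Longrightarrow> f A + f B \<le> f (A \<union> B)"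
    and "closed C"
  shows "f (C \<inter> X) + f (X - C) \<le> f X"
proof (cases "C = {} \<or> f X = top")
  case True
  then show ?thesis using empty by auto
next
  case False
  then have C: "C \<noteq> {}" and fin: "f X \<noteq> top" by auto
  \<comment> \<open>\<open>D n\<close> exhausts \<open>X - C\<close> as \<open>n\<close> grows, because \<open>C\<close> is closed.\<close>
  define D where "D n = {x\<in>X. 1 / (real n + 1) \<le> infdist x C}" for n :: nat
  define R where "R n = D (Suc n) - D n" for n :: nat
  have two: "f (A \<union> B) \<le> f A + f B" for A B
  proof -
    have "f (\<Union>i. binaryset A B i) \<le> (\<Sum>i. f (binaryset A B i))" by (rule subadd)
    then show ?thesis by (simp add: UN_binaryset_eq suminf_binaryset_eq empty)
  qed
  have sep: "f A + f B \<le> f (A \<union> B)"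
    if "s < t" and A: "\<And>x. x \<in> A \<Longrightarrow> t \<le> infdist x C" and B: "\<And>x. x \<in> B \<Longrightarrow> infdist x C \<le> s" for A B s t
  proof (rule metric[of "t - s"])
    show "0 < t - s" using that by simp
    fix x y assume "x \<in> A" "y \<in> B"
    with A[of x] B[of y] infdist_triangle[of x C y] show "t - s \<le> dist x y" by linarith
  qed
  have R_in: "1 / (real n + 2) \<le> infdist x C" "infdist x C < 1 / (real n + 1)" if "x \<in> R n" for x n
    using that by (auto simp: R_def D_def add.commute)
  have RX: "R n \<subseteq> X" for n by (auto simp: R_def D_def)
  \<comment> \<open>Distances to \<open>C\<close> in two rings of equal parity are separated by the ring between them.\<close>
  have parity: "(\<Sum>i<N. f (R (2 * i + c))) \<le> f X" for N c
  proof -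
    have "(\<Sum>i<N. f (R (2 * i + c))) \<le> f (\<Union>i<N. R (2 * i + c))"
    proof (induction N)
      case (Suc N)
      have "f (\<Union>i<N. R (2 * i + c)) + f (R (2 * N + c)) \<le> f ((\<Union>i<N. R (2 * i + c)) \<union> R (2 * N + c))"
      proof (cases "N = 0")
        case False
        show ?thesis
        proof (rule sep[of "1 / (real (2 * N + c) + 1)" "1 / real (2 * N + c)"])
          show "1 / (real (2 * N + c) + 1) < 1 / real (2 * N + c)"
            using False by (simp add: field_simps)
          fix x assume "x \<in> (\<Union>i<N. R (2 * i + c))"
          then obtain i where i: "i < N" "x \<in> R (2 * i + c)" by auto
          have "real (2 * i + c) + 2 \<le> real (2 * N + c)" using i(1) by linarith
          then have "1 / real (2 * N + c) \<le> 1 / (real (2 * i + c) + 2)"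
            by (intro divide_left_mono) auto
          with R_in(1)[OF i(2)] show "1 / real (2 * N + c) \<le> infdist x C" by linarith
        next
          fix x assume "x \<in> R (2 * N + c)"
          from R_in(2)[OF this] show "infdist x C \<le> 1 / (real (2 * N + c) + 1)" by simp
        qed
      qed (simp add: empty)
      with Suc show ?case by (simp add: lessThan_Suc Un_commute add.commute) (meson add_left_mono order_trans)
    qed (simp add: empty)
    also have "\<dots> \<le> f X" using RX by (intro mono) auto
    finally show ?thesis .
  qed
  have partial: "(\<Sum>i<2 * N. f (R i)) = (\<Sum>i<N. f (R (2 * i + 0))) + (\<Sum>i<N. f (R (2 * i + 1)))" for N
    by (induction N) (simp_all add: algebra_simps)
  have "(\<Sum>i<n. f (R i)) \<le> f X + f X" for n
  proof -
    have "(\<Sum>i<n. f (R i)) \<le> (\<Sum>i<2 * n. f (R i))" by (rule sum_mono2) auto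
    also have "\<dots> \<le> f X + f X" unfolding partial by (intro add_mono parity)
    finally show ?thesis .
  qed
  then have "(\<Sum>i. f (R i)) \<le> f X + f X" by (intro suminf_le_const) auto
  then have tot: "(\<Sum>i. f (R i)) \<noteq> top" using fin by (auto simp: top_unique ennreal_add_eq_top)
  have "(\<lambda>n. (\<Sum>i. f (R i)) - (\<Sum>i<n. f (R i))) \<longlonglongrightarrow> (\<Sum>i. f (R i)) - (\<Sum>i. f (R i))"
    using tot by (intro tendsto_diff_ennreal tendsto_const summable_LIMSEQ) auto
  moreover have "(\<Sum>i. f (R i)) - (\<Sum>i<n. f (R i)) = (\<Sum>i. f (R (i + n)))" for n
  proof -
    have eq: "(\<Sum>i. f (R i)) = (\<Sum>i. f (R (i + n))) + (\<Sum>i<n. f (R i))"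
      by (rule suminf_offset) auto
    have "(\<Sum>i<n. f (R i)) \<noteq> top" using tot unfolding eq by auto
    then show ?thesis unfolding eq by simp
  qed
  ultimately have tail: "(\<lambda>n. \<Sum>i. f (R (i + n))) \<longlonglongrightarrow> 0" using tot by simp
  have "f (C \<inter> X) + f (X - C) \<le> f X + (\<Sum>i. f (R (i + n)))" for n
  proof -
    have cover: "X - C \<subseteq> D n \<union> (\<Union>i. R (i + n))"
    proof
      fix x assume x: "x \<in> X - C"
      then have "infdist x C > 0" using \<open>closed C\<close> C
        by (metis DiffD2 in_closed_iff_infdist_zero infdist_nonneg less_eq_real_def)
      then obtain m :: nat where m: "1 / (real m + 1) < infdist x C"
        by (metis nat_approx_posE add.commute of_nat_Suc)
      then have "x \<in> D m" using x by (auto simp: D_def)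
      have "x \<in> D (k + n) \<Longrightarrow> x \<in> D n \<union> (\<Union>i. R (i + n))" for k
      proof (induction k)
        case (Suc k) then show ?case by (cases "x \<in> D (k + n)") (auto simp: R_def)
      qed auto
      moreover have "D m \<subseteq> D (m + n)" unfolding D_def
        by (auto elim!: order_trans[rotated] intro!: divide_left_mono)
      ultimately show "x \<in> D n \<union> (\<Union>i. R (i + n))" using \<open>x \<in> D m\<close> by blast
    qed
    have "f (X - C) \<le> f (D n \<union> (\<Union>i. R (i + n)))" by (rule mono[OF cover])
    also have "\<dots> \<le> f (D n) + f (\<Union>i. R (i + n))" by (rule two)
    also have "\<dots> \<le> f (D n) + (\<Sum>i. f (R (i + n)))" by (intro add_left_mono subadd)
    finally have 1: "f (X - C) \<le> f (D n) + (\<Sum>i. f (R (i + n)))" .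
    have "f (D n) + f (C \<inter> X) \<le> f (D n \<union> (C \<inter> X))"
      by (rule sep[of 0 "1 / (real n + 1)"]) (auto simp: D_def)
    also have "\<dots> \<le> f X" by (rule mono) (auto simp: D_def)
    finally have 2: "f (C \<inter> X) + f (D n) \<le> f X" by (simp add: add.commute)
    have "f (C \<inter> X) + f (X - C) \<le> f (C \<inter> X) + (f (D n) + (\<Sum>i. f (R (i + n))))"
      by (intro add_left_mono 1)
    also have "\<dots> \<le> f X + (\<Sum>i. f (R (i + n)))" unfolding add.assoc[symmetric]
      by (intro add_right_mono 2)
    finally show ?thesis .
  qed
  moreover have "(\<lambda>n. f X + (\<Sum>i. f (R (i + n)))) \<longlonglongrightarrow> f X + 0"
    using tail by (intro tendsto_add tendsto_const)
  ultimately show ?thesis using tendsto_lowerbound[of _ "f X + 0" sequentially "f (C \<inter> X) + f (X - C)"]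
    by (simp)
qed

lemma metric_outer_measure_borel:
  fixes f :: "'a::metric_space set \<Rightarrow> ennreal"
  assumes empty: "f {} = 0"
    and mono: "\<And>A B. A \<subseteq> B \<Longrightarrow> f A \<le> f B"
    and subadd: "\<And>A. f (\<Union>i. A i) \<le> (\<Sum>i::nat. f (A i))"
    and metric: "\<And>A B e. e > 0 \<Longrightarrow> (\<And>x y. x \<in> A \<Longrightarrow> y \<in> B \<Longrightarrow> e \<le> dist x y) \<Longrightarrow> f A + f B \<le> f (A \<union> B)"
  shows "measure_space UNIV (sets borel) f"
proof -
  let ?L = "lambda_system UNIV (Pow UNIV) f"
  have "outer_measure_space (Pow UNIV) f"
    unfolding outer_measure_space_def positive_def increasing_def countably_subadditive_def
    using empty mono subadd by auto
  then have L: "measure_space UNIV ?L f"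
    by (rule sigma_algebra.caratheodory_lemma[OF sigma_algebra_Pow])
  have "C \<in> ?L" if "closed C" for C
  proof -
    have "f (C \<inter> X) + f (X - C) = f X" for X
    proof (rule antisym)
      show "f (C \<inter> X) + f (X - C) \<le> f X"
        by (rule metric_outer_measure_closed_additive[OF assms \<open>closed C\<close>])
      have "f (\<Union>i. binaryset (C \<inter> X) (X - C) i) \<le> (\<Sum>i. f (binaryset (C \<inter> X) (X - C) i))"
        by (rule subadd)
      moreover have "(C \<inter> X) \<union> (X - C) = X" by auto
      ultimately show "f X \<le> f (C \<inter> X) + f (X - C)"
        by (simp add: UN_binaryset_eq suminf_binaryset_eq empty)
    qed
    then show ?thesis unfolding lambda_system_def by (simp add: Diff_eq Int_commute)
  qed
  then have "Collect closed \<subseteq> ?L" by auto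
  then have "sigma_sets UNIV (Collect closed) \<subseteq> ?L"
    using L sigma_algebra.sigma_sets_subset unfolding measure_space_def by blast
  then have "sets borel \<subseteq> ?L" by (simp add: borel_eq_closed)
  then show ?thesis using L unfolding measure_space_def
    by (auto simp: positive_def countably_additive_def sets.sigma_algebra_axioms
          intro: sets.sigma_algebra_axioms[of borel, simplified])
qed

section \<open>Hausdorff measure\<close>

lemma hausdorff_content_le:
  assumes "A \<subseteq> (\<Union>i. C i)" "\<And>i. bounded (C i)" "\<And>i. diameter (C i) \<le> \<delta>"
  shows "hausdorff_content s \<delta> A \<le> (\<Sum>i. hausdorff_weight s (C i))"
  unfolding hausdorff_content_def using assms by (intro Inf_lower) blast

lemma hausdorff_content_antimono:
  assumes "\<delta> \<le> \<epsilon>" shows "hausdorff_content s \<epsilon> A \<le> hausdorff_content s \<delta> A"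
  unfolding hausdorff_content_def using assms by (intro Inf_superset_mono) (blast intro: order_trans)

lemma hausdorff_content_mono:
  assumes "A \<subseteq> B" shows "hausdorff_content s \<delta> A \<le> hausdorff_content s \<delta> B"
  unfolding hausdorff_content_def using assms by (intro Inf_superset_mono) blast

lemma hausdorff_content_subadditive:
  "hausdorff_content s \<delta> (\<Union>n. A n) \<le> (\<Sum>n::nat. hausdorff_content s \<delta> (A n))"
proof (rule ennreal_le_epsilon)
  let ?O = "hausdorff_content s \<delta>"
  fix e :: real assume "0 < e" "(\<Sum>n. ?O (A n)) < top"
  then have *: "\<And>n. ?O (A n) < ?O (A n) + e * (1/2)^Suc n"
    by (auto simp add: less_top dest!: ennreal_suminf_lessD)
  have "\<exists>C. A n \<subseteq> (\<Union>i. C i) \<and> (\<forall>i. bounded (C i) \<and> diameter (C i) \<le> \<delta>) \<and>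
      (\<Sum>i. hausdorff_weight s (C i)) < ?O (A n) + e * (1/2)^Suc n" for n
    using *[of n] by (subst (asm) hausdorff_content_def) (auto simp: Inf_less_iff)
  then obtain B where B: "\<And>n. A n \<subseteq> (\<Union>i. B n i)" "\<And>n i. bounded (B n i)" "\<And>n i. diameter (B n i) \<le> \<delta>"
    "\<And>n. (\<Sum>i. hausdorff_weight s (B n i)) \<le> ?O (A n) + e * (1/2)^Suc n"
    by (metis less_imp_le)
  define C where "C = case_prod B o prod_decode"
  have AC: "(\<Union>n. A n) \<subseteq> (\<Union>i. C i)"
    using B(1) by (auto simp add: C_def subset_eq) (metis prod.case prod_encode_inverse)
  have "?O (\<Union>n. A n) \<le> (\<Sum>i. hausdorff_weight s (C i))"
    using B(2,3) by (intro hausdorff_content_le AC) (auto simp: C_def split: prod.split)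
  also have "\<dots> = (\<Sum>n. \<Sum>i. hausdorff_weight s (B n i))"
    unfolding C_def comp_def by (subst suminf_ennreal_2dimen[symmetric]) (auto simp: split_def intro: arg_cong[where f=suminf])
  also have "\<dots> \<le> (\<Sum>n. ?O (A n) + e * (1/2) ^ Suc n)"
    by (intro suminf_le allI B(4)) auto
  also have "... = (\<Sum>n. ?O (A n)) + (\<Sum>n. ennreal e * ennreal ((1/2) ^ Suc n))"
    using \<open>0 < e\<close> by (subst suminf_add[symmetric])
                     (auto simp del: ennreal_suminf_cmult simp add: ennreal_mult[symmetric])
  also have "\<dots> = (\<Sum>n. ?O (A n)) + e"
    unfolding ennreal_suminf_cmult
    by (subst suminf_ennreal_eq[OF zero_le_power power_half_series]) auto
  finally show "?O (\<Union>n. A n) \<le> (\<Sum>n. ?O (A n)) + e" .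
qed

text \<open>
  A covering set of diameter at most \<open>\<delta>\<close> meets only one of the two sets, so every cover of the union
  splits into covers of the parts.
\<close>

lemma hausdorff_content_separated:
  assumes "\<And>x y. x \<in> A \<Longrightarrow> y \<in> B \<Longrightarrow> \<delta> < dist x y"
  shows "hausdorff_content s \<delta> A + hausdorff_content s \<delta> B \<le> hausdorff_content s \<delta> (A \<union> B)"
proof -
  have "hausdorff_content s \<delta> A + hausdorff_content s \<delta> B \<le> (\<Sum>i. hausdorff_weight s (C i))"
    if C: "A \<union> B \<subseteq> (\<Union>i. C i)" "\<forall>i. bounded (C i) \<and> diameter (C i) \<le> \<delta>" for C
  proof -
    define CA where "CA i = (if C i \<inter> A = {} then {} else C i)" for i
    define CB where "CB i = (if C i \<inter> A = {} then C i else {})" for i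
    have "0 \<le> \<delta>" using C(2) diameter_ge_0 order_trans by blast
    have "hausdorff_content s \<delta> A \<le> (\<Sum>i. hausdorff_weight s (CA i))"
    proof (rule hausdorff_content_le)
      show "A \<subseteq> (\<Union>i. CA i)"
        using C(1) unfolding CA_def by fastforce
    qed (use C \<open>0 \<le> \<delta>\<close> in \<open>auto simp: CA_def\<close>)
    moreover have "hausdorff_content s \<delta> B \<le> (\<Sum>i. hausdorff_weight s (CB i))"
    proof (rule hausdorff_content_le)
      show "B \<subseteq> (\<Union>i. CB i)"
      proof
        fix y assume "y \<in> B"
        then obtain i where i: "y \<in> C i" using C(1) by auto
        have "C i \<inter> A = {}"
        proof (rule ccontr)
          assume "C i \<inter> A \<noteq> {}"
          then obtain x where x: "x \<in> C i" "x \<in> A" by auto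
          have "dist x y \<le> \<delta>" using diameter_bounded_bound[of "C i" x y] C(2) x i by (meson order_trans)
          with assms[OF x(2) \<open>y \<in> B\<close>] show False by simp
        qed
        then show "y \<in> (\<Union>i. CB i)" using i by (auto simp: CB_def)
      qed
    qed (use C \<open>0 \<le> \<delta>\<close> in \<open>auto simp: CB_def\<close>)
    ultimately have "hausdorff_content s \<delta> A + hausdorff_content s \<delta> B
        \<le> (\<Sum>i. hausdorff_weight s (CA i)) + (\<Sum>i. hausdorff_weight s (CB i))"
      by (rule add_mono)
    also have "\<dots> = (\<Sum>i. hausdorff_weight s (CA i) + hausdorff_weight s (CB i))"
      by (rule suminf_add) auto
    also have "\<dots> = (\<Sum>i. hausdorff_weight s (C i))"
      by (intro suminf_cong) (auto simp: CA_def CB_def hausdorff_weight_def)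
    finally show ?thesis .
  qed
  then show ?thesis
    unfolding hausdorff_content_def[of s \<delta> "A \<union> B"] by (intro Inf_greatest) blast
qed

lemma hausdorff_content_le_outer: "\<delta> > 0 \<Longrightarrow> hausdorff_content s \<delta> A \<le> hausdorff_outer s A"
  unfolding hausdorff_outer_def by (rule SUP_upper) auto

lemma measure_space_hausdorff_outer:
  "measure_space UNIV (sets borel) (hausdorff_outer s :: 'a::metric_space set \<Rightarrow> ennreal)"
proof (rule metric_outer_measure_borel)
  show "hausdorff_outer s ({} :: 'a set) = 0"
  proof -
    have "hausdorff_content s \<delta> ({} :: 'a set) \<le> 0" if "\<delta> > 0" for \<delta>
      using hausdorff_content_le[of "{}" "\<lambda>_. {} :: 'a set" \<delta> s] that by (simp add: hausdorff_weight_def)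
    then show ?thesis unfolding hausdorff_outer_def by (auto simp: SUP_eq_const intro!: antisym SUP_least)
  qed
next
  fix A B :: "'a set" assume "A \<subseteq> B"
  then show "hausdorff_outer s A \<le> hausdorff_outer s B"
    unfolding hausdorff_outer_def by (intro SUP_mono) (auto intro: hausdorff_content_mono)
next
  fix A :: "nat \<Rightarrow> 'a set"
  show "hausdorff_outer s (\<Union>i. A i) \<le> (\<Sum>i. hausdorff_outer s (A i))"
    unfolding hausdorff_outer_def[of s "\<Union>i. A i"]
  proof (rule SUP_least)
    fix \<delta> :: real assume "\<delta> \<in> {0<..}"
    then show "hausdorff_content s \<delta> (\<Union>i. A i) \<le> (\<Sum>i. hausdorff_outer s (A i))"
      by (intro order_trans[OF hausdorff_content_subadditive] suminf_le hausdorff_content_le_outer) auto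
  qed
next
  fix A B :: "'a set" and e :: real
  assume e: "e > 0" and sep: "\<And>x y. x \<in> A \<Longrightarrow> y \<in> B \<Longrightarrow> e \<le> dist x y"
  have *: "hausdorff_content s d1 A + hausdorff_content s d2 B \<le> hausdorff_outer s (A \<union> B)"
    if "d1 > 0" "d2 > 0" for d1 d2
  proof -
    define m where "m = min (min d1 d2) (e / 2)"
    have m: "m > 0" "m \<le> d1" "m \<le> d2" "m < e" using that e by (auto simp: m_def)
    have "hausdorff_content s d1 A + hausdorff_content s d2 B \<le> hausdorff_content s m A + hausdorff_content s m B"
      by (intro add_mono hausdorff_content_antimono m)
    also have "\<dots> \<le> hausdorff_content s m (A \<union> B)"
      by (rule hausdorff_content_separated) (use m sep in fastforce)
    also have "\<dots> \<le> hausdorff_outer s (A \<union> B)" by (rule hausdorff_content_le_outer[OF m(1)])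
    finally show ?thesis .
  qed
  have ne: "{0::real<..} \<noteq> {}" by auto
  have "hausdorff_outer s A + hausdorff_outer s B
      = (SUP d1\<in>{0<..}. hausdorff_content s d1 A + hausdorff_outer s B)"
    unfolding hausdorff_outer_def[of s A] by (rule ennreal_SUP_add_left[OF ne, symmetric])
  also have "\<dots> = (SUP d1\<in>{0<..}. SUP d2\<in>{0<..}. hausdorff_content s d1 A + hausdorff_content s d2 B)"
    unfolding hausdorff_outer_def[of s B] by (subst ennreal_SUP_add_right[OF ne]) simp
  also have "\<dots> \<le> hausdorff_outer s (A \<union> B)" using * by (intro SUP_least) auto
  finally show "hausdorff_outer s A + hausdorff_outer s B \<le> hausdorff_outer s (A \<union> B)" .
qed

lemma sets_surface_measure [simp, measurable_cong]:
  "sets (surface_measure :: 'a::euclidean_space measure) = sets borel"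
  unfolding surface_measure_def hausdorff_measure_def
  by (metis sets.sets_measure_of_eq space_borel)

lemma emeasure_surface_measure:
  assumes "A \<in> sets (borel :: 'a::euclidean_space measure)"
  shows "emeasure surface_measure A = hausdorff_outer (DIM('a) - 1) A"
  unfolding surface_measure_def hausdorff_measure_def
  using measure_space_hausdorff_outer[where 'a='a, of "DIM('a) - 1"] assms
  by (intro emeasure_measure_of_sigma) (auto simp: measure_space_def)

text \<open>
  Packing estimate. Translating an \<open>\<epsilon>\<close>-separated subset of the hyperplane along the normal by the
  multiples \<open>j \<epsilon> \<le> 1\<close> gives about \<open>1/\<epsilon>\<close> times as many points, which are again \<open>\<epsilon>\<close>-separated in the
  whole space by Pythagoras. Comparing the volume of the disjoint balls of radius \<open>\<epsilon>/2\<close> with that of a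
  large ball bounds their number, and saves one power of \<open>\<epsilon>\<close>.
\<close>

lemma card_separated_subset_hyperplane:
  fixes a :: "'a::euclidean_space"
  assumes a: "norm a = 1" and E: "finite E" "\<And>x. x \<in> E \<Longrightarrow> a \<bullet> x = c" "\<And>x. x \<in> E \<Longrightarrow> norm x \<le> R"
    and sep: "\<And>x y. x \<in> E \<Longrightarrow> y \<in> E \<Longrightarrow> x \<noteq> y \<Longrightarrow> \<epsilon> \<le> dist x y"
    and eps: "0 < \<epsilon>" "\<epsilon> \<le> 1" and R: "0 \<le> R"
  shows "real (card E) * \<epsilon> ^ (DIM('a) - 1) \<le> (2 * (R + 2)) ^ DIM('a)"
proof -
  define N where "N = nat \<lfloor>1 / \<epsilon>\<rfloor>"
  have N: "real N * \<epsilon> \<le> 1" "1 \<le> (real N + 1) * \<epsilon>"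
  proof -
    have "real N = of_int \<lfloor>1 / \<epsilon>\<rfloor>" using eps by (simp add: N_def)
    then have "real N \<le> 1 / \<epsilon>" "1 / \<epsilon> \<le> real N + 1"
      using floor_correct[of "1 / \<epsilon>"] by linarith+
    then show "real N * \<epsilon> \<le> 1" "1 \<le> (real N + 1) * \<epsilon>" using eps by (simp_all add: field_simps)
  qed
  define p where "p = (\<lambda>(x, j). x + (real j * \<epsilon>) *\<^sub>R a)"
  let ?I = "E \<times> {..N}"
  let ?v = "unit_ball_vol (real DIM('a))"
  have far: "\<epsilon> \<le> dist (p i) (p i')" if "i \<in> ?I" "i' \<in> ?I" "i \<noteq> i'" for i i'
  proof -
    obtain x j y m where ij: "i = (x, j)" "i' = (y, m)" by (metis surj_pair)
    have xy: "a \<bullet> (x - y) = 0" using that E(2) by (auto simp: ij inner_diff_right)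
    have "p i - p i' = (x - y) + ((real j - real m) * \<epsilon>) *\<^sub>R a"
      by (simp add: p_def ij algebra_simps)
    then have "(dist (p i) (p i'))\<^sup>2 = (norm (x - y))\<^sup>2 + (norm (((real j - real m) * \<epsilon>) *\<^sub>R a))\<^sup>2"
      using xy norm_add_Pythagorean[of "x - y" "((real j - real m) * \<epsilon>) *\<^sub>R a"]
      by (simp add: dist_norm orthogonal_def inner_commute)
    then have eq: "(dist (p i) (p i'))\<^sup>2 = (norm (x - y))\<^sup>2 + ((real j - real m) * \<epsilon>)\<^sup>2"
      using a by (simp add: power_mult_distrib)
    have "\<epsilon>\<^sup>2 \<le> (dist (p i) (p i'))\<^sup>2"
    proof (cases "x = y")
      case False
      then have "\<epsilon>\<^sup>2 \<le> (norm (x - y))\<^sup>2"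
        using sep[of x y] that eps by (intro power_mono) (auto simp: ij dist_norm)
      then show ?thesis unfolding eq by (simp add: add_increasing2)
    next
      case True
      then have "1 \<le> \<bar>real j - real m\<bar>" using that by (auto simp: ij)
      then have "1 \<le> (real j - real m)\<^sup>2" using power_mono[of 1 "\<bar>real j - real m\<bar>" 2] by simp
      then have "\<epsilon>\<^sup>2 \<le> (real j - real m)\<^sup>2 * \<epsilon>\<^sup>2" using mult_right_mono[of 1 "(real j - real m)\<^sup>2" "\<epsilon>\<^sup>2"] by simp
      then show ?thesis unfolding eq by (simp add: power_mult_distrib add_increasing)
    qed
    then show ?thesis using eps by (meson power2_le_imp_le zero_le_dist)
  qed
  have disj: "disjoint_family_on (\<lambda>i. ball (p i) (\<epsilon> / 2)) ?I"
    unfolding disjoint_family_on_def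
  proof (intro ballI impI equals0I)
    fix i i' z assume i: "i \<in> ?I" "i' \<in> ?I" "i \<noteq> i'" and z: "z \<in> ball (p i) (\<epsilon> / 2) \<inter> ball (p i') (\<epsilon> / 2)"
    then have "dist (p i) (p i') < \<epsilon>"
      using dist_triangle_half_r[of z "p i" \<epsilon> "p i'"] by (simp add: dist_commute)
    with far[OF i] show False by simp
  qed
  have fin: "emeasure lborel (ball (p i) (\<epsilon> / 2)) \<noteq> \<infinity>" for i
    using emeasure_lborel_ball_finite[of "p i" "\<epsilon> / 2"] by simp
  have "(\<Sum>i\<in>?I. measure lborel (ball (p i) (\<epsilon> / 2))) = measure lborel (\<Union>i\<in>?I. ball (p i) (\<epsilon> / 2))"
    using E(1) disj by (intro measure_finite_Union[symmetric] fin) auto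
  also have "\<dots> \<le> measure lborel (cball (0::'a) (R + 2))"
  proof (rule measure_mono_fmeasurable)
    show "(\<Union>i\<in>?I. ball (p i) (\<epsilon> / 2)) \<subseteq> cball (0::'a) (R + 2)"
    proof
      fix z assume "z \<in> (\<Union>i\<in>?I. ball (p i) (\<epsilon> / 2))"
      then obtain x j where x: "x \<in> E" "j \<le> N" and z: "dist (p (x, j)) z < \<epsilon> / 2" by auto
      have "real j * \<epsilon> \<le> real N * \<epsilon>" using x eps by (intro mult_right_mono) auto
      then have "real j * \<epsilon> \<le> 1" using N(1) by linarith
      then have "norm ((real j * \<epsilon>) *\<^sub>R a) \<le> 1" using eps a by simp
      then have "norm (p (x, j)) \<le> R + 1" using E(3)[OF x(1)] norm_triangle_le[of x "(real j * \<epsilon>) *\<^sub>R a" "R + 1"]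
        by (simp add: p_def)
      moreover have "norm z \<le> norm (p (x, j)) + dist (p (x, j)) z"
        by (metis dist_commute dist_norm norm_triangle_sub)
      ultimately have "norm z \<le> R + 2" using z eps by linarith
      then show "z \<in> cball 0 (R + 2)" by simp
    qed
  next
    show "cball (0::'a) (R + 2) \<in> fmeasurable lborel"
      using emeasure_lborel_cball_finite[of 0 "R + 2"] by (intro fmeasurableI) auto
  qed (auto intro!: borel_open)
  finally have "(\<Sum>i\<in>?I. ?v * (\<epsilon> / 2) ^ DIM('a)) \<le> ?v * (R + 2) ^ DIM('a)"
    using eps R by (simp add: content_ball content_cball)
  then have "?v * (real (card E) * (real N + 1) * (\<epsilon> / 2) ^ DIM('a)) \<le> ?v * (R + 2) ^ DIM('a)"
    by (simp add: card_cartesian_product algebra_simps)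
  moreover have "?v > 0" by simp
  ultimately have "real (card E) * (real N + 1) * (\<epsilon> / 2) ^ DIM('a) \<le> (R + 2) ^ DIM('a)"
    by (metis mult_le_cancel_left_pos)
  then have "2 ^ DIM('a) * (real (card E) * (real N + 1) * (\<epsilon> / 2) ^ DIM('a)) \<le> 2 ^ DIM('a) * (R + 2) ^ DIM('a)"
    by (intro mult_left_mono) auto
  moreover have "2 ^ DIM('a) * (\<epsilon> / 2) ^ DIM('a) = \<epsilon> ^ DIM('a)"
    unfolding power_mult_distrib[symmetric] by simp
  ultimately have "real (card E) * ((real N + 1) * \<epsilon> ^ DIM('a)) \<le> (2 * (R + 2)) ^ DIM('a)"
    by (simp only: power_mult_distrib mult.assoc mult.left_commute)
  moreover have "\<epsilon> ^ DIM('a) = \<epsilon> * \<epsilon> ^ (DIM('a) - 1)"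
    using DIM_positive[where 'a='a] by (metis power_eq_if not_gr_zero)
  moreover have "real (card E) * \<epsilon> ^ (DIM('a) - 1) \<le> real (card E) * (((real N + 1) * \<epsilon>) * \<epsilon> ^ (DIM('a) - 1))"
    using N(2) eps mult_right_mono[of 1 "(real N + 1) * \<epsilon>" "\<epsilon> ^ (DIM('a) - 1)"]
    by (intro mult_left_mono) auto
  ultimately show ?thesis by (simp add: mult.assoc)
qed

text \<open>
  A maximal \<open>\<epsilon>\<close>-separated subset of \<open>P\<close> is an \<open>\<epsilon>\<close>-net, and by the packing estimate the balls of
  radius \<open>\<epsilon>\<close> around it have a total weight that is bounded independently of \<open>\<epsilon>\<close>.
\<close>

lemma hausdorff_outer_bounded_hyperplane_finite:
  fixes P :: "'a::euclidean_space set"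
  assumes "bounded P" and "a \<noteq> 0" "P \<subseteq> {x. a \<bullet> x = c}"
  shows "hausdorff_outer (DIM('a) - 1) P < top"
proof -
  let ?s = "DIM('a) - 1"
  define n where "n = a /\<^sub>R norm a"
  have n: "norm n = 1" "\<And>x. x \<in> P \<Longrightarrow> n \<bullet> x = c / norm a"
    using assms by (auto simp: n_def divide_simps)
  obtain R where R: "R > 0" "\<And>x. x \<in> P \<Longrightarrow> norm x \<le> R"
    using \<open>bounded P\<close> by (auto simp: bounded_pos)
  define K where "K = (2 * (R + 2)) ^ DIM('a)"
  let ?v = "unit_ball_vol (real ?s)"
  have "hausdorff_content ?s \<delta> P \<le> ennreal (?v * K)" if "\<delta> > 0" for \<delta>
  proof -
    define \<epsilon> where "\<epsilon> = min (\<delta> / 2) 1"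
    have eps: "0 < \<epsilon>" "\<epsilon> \<le> 1" "2 * \<epsilon> \<le> \<delta>" using that by (auto simp: \<epsilon>_def)
    define good where "good E \<longleftrightarrow> finite E \<and> E \<subseteq> P \<and> (\<forall>x\<in>E. \<forall>y\<in>E. x \<noteq> y \<longrightarrow> \<epsilon> \<le> dist x y)" for E
    have bound: "real (card E) * \<epsilon> ^ ?s \<le> K" if "good E" for E
      unfolding K_def using that R n eps unfolding good_def
      by (intro card_separated_subset_hyperplane[of n E "c / norm a"]) (auto simp: less_imp_le)
    have "card E < nat \<lceil>K / \<epsilon> ^ ?s\<rceil> + 1" if "good E" for E
    proof -
      have "real (card E) \<le> K / \<epsilon> ^ ?s" using bound[OF that] eps by (simp add: field_simps)
      then show ?thesis by linarith
    qed
    moreover have "good {}" by (simp add: good_def)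
    ultimately obtain E where E: "good E" "\<And>E'. good E' \<Longrightarrow> card E' \<le> card E"
      using Lattices_Big.ex_has_greatest_nat[of good "{}" card "nat \<lceil>K / \<epsilon> ^ ?s\<rceil> + 1"] by blast
    have cov: "\<exists>x\<in>E. dist x z \<le> \<epsilon>" if "z \<in> P" for z
    proof (rule ccontr)
      assume "\<not> ?thesis"
      then have z: "\<And>x. x \<in> E \<Longrightarrow> \<epsilon> < dist x z" by force
      then have "z \<notin> E" using eps by force
      have "good (insert z E)" using E(1) z that unfolding good_def by (auto simp: dist_commute less_imp_le)
      from E(2)[OF this] \<open>z \<notin> E\<close> E(1) show False by (simp add: good_def)
    qed
    obtain h where h: "bij_betw h {0..<card E} E"
      using ex_bij_betw_nat_finite E(1) unfolding good_def by blast
    define C where "C i = (if i < card E then cball (h i) \<epsilon> else {})" for i :: nat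
    have diam: "diameter (cball (h i) \<epsilon>) \<le> 2 * \<epsilon>" for i
      using eps by (simp add: diameter_cball)
    have "hausdorff_content ?s \<delta> P \<le> (\<Sum>i. hausdorff_weight ?s (C i))"
    proof (rule hausdorff_content_le)
      show "P \<subseteq> (\<Union>i. C i)"
      proof
        fix z assume "z \<in> P"
        from cov[OF this] obtain x where x: "x \<in> E" "dist x z \<le> \<epsilon>" by auto
        then obtain i where "i < card E" "h i = x" using bij_betw_imp_surj_on[OF h] by force
        then show "z \<in> (\<Union>i. C i)" using x by (auto simp: C_def intro!: exI[of _ i])
      qed
    qed (use diam eps in \<open>auto simp: C_def intro: order_trans\<close>)
    also have "\<dots> = (\<Sum>i<card E. hausdorff_weight ?s (C i))"
      by (rule suminf_finite) (auto simp: C_def hausdorff_weight_def)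
    also have "\<dots> \<le> (\<Sum>i<card E. ennreal (?v * \<epsilon> ^ ?s))"
    proof (rule sum_mono)
      fix i assume "i \<in> {..<card E}"
      have "(diameter (cball (h i) \<epsilon>) / 2) ^ ?s \<le> \<epsilon> ^ ?s"
        using diam[of i] diameter_ge_0[of "cball (h i) \<epsilon>"] by (intro power_mono) auto
      then show "hausdorff_weight ?s (C i) \<le> ennreal (?v * \<epsilon> ^ ?s)"
        by (auto simp: C_def hausdorff_weight_def intro!: ennreal_leI mult_left_mono)
    qed
    also have "\<dots> = ennreal (?v * (real (card E) * \<epsilon> ^ ?s))"
      using eps by (simp add: ennreal_of_nat_eq_real_of_nat ennreal_mult[symmetric] mult.left_commute)
    also have "\<dots> \<le> ennreal (?v * K)" using bound[OF E(1)] by (intro ennreal_leI mult_left_mono) auto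
    finally show ?thesis .
  qed
  then have "hausdorff_outer ?s P \<le> ennreal (?v * K)"
    unfolding hausdorff_outer_def by (intro SUP_least) auto
  also have "\<dots> < top" by simp
  finally show ?thesis .
qed

text \<open>
  Lower bound by comparison with volume. Sliding \<open>Q\<close> by one unit along a coordinate direction that
  is transverse to its hyperplane sweeps out a convex body of positive volume. The same slide turns
  a covering set of diameter \<open>D \<le> 1\<close> into a set of volume at most a constant times \<open>D ^ (d - 1)\<close>,
  that is, at most a constant times its weight.
\<close>

lemma hausdorff_outer_convex_pos:
  fixes Q :: "'a::euclidean_space set"
  assumes Q: "convex Q" "bounded Q" "aff_dim Q = int DIM('a) - 1" "Q \<noteq> {}"
  shows "0 < hausdorff_outer (DIM('a) - 1) Q"
proof -
  let ?s = "DIM('a) - 1"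
  obtain a c where a: "a \<noteq> 0" "Q \<subseteq> {x. a \<bullet> x = c}"
    using aff_lowdim_subset_hyperplane[of Q] Q(3) by auto
  have hullQ: "affine hull Q = {x. a \<bullet> x = c}"
    using aff_dim_eq_full_gen[OF a(2)] Q(3) a(1) by (simp add: aff_dim_hyperplane affine_hyperplane hull_same)
  obtain b where b: "b \<in> Basis" "a \<bullet> b \<noteq> 0"
    using a(1) by (meson euclidean_all_zero_iff)
  define Q' where "Q' = (\<Union>x\<in>Q. \<Union>y\<in>closed_segment 0 b. {x + y})"
  have cQ': "convex Q'" unfolding Q'_def by (intro convex_sums Q convex_closed_segment)
  have bQ': "bounded Q'"
  proof -
    have "Q' = (\<lambda>(x, y). x + y) ` (Q \<times> closed_segment 0 b)" by (auto simp: Q'_def)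
    then show ?thesis using bounded_sums[OF Q(2) bounded_closed_segment, of 0 b] by (auto simp: Q'_def image_def)
  qed
  \<comment> \<open>Otherwise \<open>Q\<close> would lie in two different hyperplanes, the second parallel to \<open>b\<close>.\<close>
  have int: "interior Q' \<noteq> {}"
  proof
    assume "interior Q' = {}"
    then obtain a' c' where a': "a' \<noteq> 0" "Q' \<subseteq> {x. a' \<bullet> x = c'}"
      using empty_interior_subset_hyperplane[OF cQ'] by metis
    have Qa': "a' \<bullet> x = c'" if "x \<in> Q" for x
    proof -
      have "x + 0 \<in> Q'" unfolding Q'_def using that by blast
      then show ?thesis using a'(2) by auto
    qed
    obtain x0 where x0: "x0 \<in> Q" using Q(4) by auto
    then have "x0 + b \<in> Q'" unfolding Q'_def by blast
    then have a'b: "a' \<bullet> b = 0" using a'(2) Qa'[OF x0] by (auto simp: inner_add_right)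
    have "affine hull Q \<subseteq> {x. a' \<bullet> x = c'}" by (rule hull_minimal) (auto simp: Qa' affine_hyperplane)
    then have sub: "{x. a \<bullet> x = c} \<subseteq> {x. a' \<bullet> x = c'}" by (simp add: hullQ)
    \<comment> \<open>Correcting \<open>a'\<close> along \<open>b\<close> gives a direction inside the hyperplane of \<open>Q\<close>.\<close>
    define u where "u = x0 + (a' - ((a \<bullet> a') / (a \<bullet> b)) *\<^sub>R b)"
    have "a \<bullet> u = c" using a(2) x0 b(2) by (auto simp: u_def inner_add_right inner_diff_right)
    then have "a' \<bullet> u = c'" using sub by auto
    then have "a' \<bullet> a' = 0" using a'b Qa'[OF x0] by (simp add: u_def inner_add_right inner_diff_right)
    then show False using a'(1) by simp
  qed
  have meas: "Q' \<in> sets lebesgue" using measurable_convex[OF cQ' bQ'] by auto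
  have pos: "emeasure lebesgue Q' > 0"
    using int negligible_convex_interior[OF cQ'] meas
    by (auto simp: negligible_iff_null_sets zero_less_iff_neq_zero)
  let ?v = "unit_ball_vol (real ?s)"
  define \<kappa> where "\<kappa> = 3 * 4 ^ ?s / ?v"
  have \<kappa>: "\<kappa> > 0" by (simp add: \<kappa>_def)
  \<comment> \<open>The slide of a set of diameter \<open>D\<close> lies in a box with sides \<open>2 D\<close>, except \<open>2 D + 1 \<le> 3\<close> along \<open>b\<close>.\<close>
  have prism: "emeasure lebesgue Q' \<le> ennreal \<kappa> * (\<Sum>i. hausdorff_weight ?s (C i))"
    if C: "Q \<subseteq> (\<Union>i. C i)" "\<And>i. bounded (C i)" "\<And>i. diameter (C i) \<le> 1" for C :: "nat \<Rightarrow> 'a set"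
  proof -
    define D where "D i = diameter (C i)" for i
    have D: "0 \<le> D i" "D i \<le> 1" for i using diameter_ge_0 C by (auto simp: D_def)
    define z where "z i = (SOME z. z \<in> C i)" for i
    define B where "B i = (if C i = {} then {} else cbox (z i - D i *\<^sub>R One) (z i + D i *\<^sub>R One + b))" for i
    have "Q' \<subseteq> (\<Union>i. B i)"
    proof
      fix q assume "q \<in> Q'"
      then obtain x t where x: "x \<in> Q" and t: "0 \<le> t" "t \<le> 1" "q = x + t *\<^sub>R b"
        unfolding Q'_def closed_segment_def by auto
      obtain i where i: "x \<in> C i" using x C(1) by auto
      then have z: "z i \<in> C i" unfolding z_def by (rule someI)
      have "norm (x - z i) \<le> D i" using diameter_bounded_bound[OF C(2) i z] by (simp add: D_def dist_norm)
      then have "\<bar>(x - z i) \<bullet> j\<bar> \<le> D i" if "j \<in> Basis" for j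
        using Basis_le_norm[OF that, of "x - z i"] by linarith
      then have "q \<in> cbox (z i - D i *\<^sub>R One) (z i + D i *\<^sub>R One + b)"
        unfolding mem_box t(3) using t(1,2) b(1)
        by (auto simp: inner_add_left inner_diff_left inner_Basis abs_le_iff algebra_simps split: if_splits) force+
      then show "q \<in> (\<Union>i. B i)" using i by (auto simp: B_def)
    qed
    then have "emeasure lebesgue Q' \<le> emeasure lebesgue (\<Union>i. B i)"
      by (rule emeasure_mono) (auto simp: B_def)
    also have "\<dots> \<le> (\<Sum>i. emeasure lebesgue (B i))"
      by (rule emeasure_subadditive_countably) (auto simp: B_def)
    also have "\<dots> \<le> (\<Sum>i. ennreal \<kappa> * hausdorff_weight ?s (C i))"
    proof (rule suminf_le)
      fix i
      show "emeasure lebesgue (B i) \<le> ennreal \<kappa> * hausdorff_weight ?s (C i)"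
      proof (cases "C i = {}")
        case False
        have "(\<Prod>j\<in>Basis. ((z i + D i *\<^sub>R One + b) - (z i - D i *\<^sub>R One)) \<bullet> j)
            = (\<Prod>j\<in>Basis. 2 * D i + (if j = b then 1 else 0))"
          using b(1) by (intro prod.cong) (auto simp: inner_add_left inner_diff_left inner_Basis)
        also have "\<dots> = (2 * D i + 1) * (2 * D i) ^ ?s"
          using b(1) by (subst prod.remove[of _ b]) (auto simp: card_Diff_singleton)
        also have "\<dots> \<le> 3 * (2 * D i) ^ ?s" using D[of i] by (intro mult_right_mono) auto
        also have "\<dots> = \<kappa> * (?v * (D i / 2) ^ ?s)"
        proof -
          have "(2 * D i) ^ ?s = 4 ^ ?s * (D i / 2) ^ ?s" unfolding power_mult_distrib[symmetric] by simp
          moreover have "?v \<noteq> 0" by (metis less_irrefl of_nat_0_le_iff unit_ball_vol_pos)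
          ultimately show ?thesis by (simp add: \<kappa>_def)
        qed
        finally show ?thesis using False D[of i] b(1) \<kappa>
          by (auto simp: B_def hausdorff_weight_def D_def[symmetric] emeasure_lborel_cbox_eq ennreal_mult[symmetric] ennreal_leI)
      qed (simp add: B_def)
    qed auto
    also have "\<dots> = ennreal \<kappa> * (\<Sum>i. hausdorff_weight ?s (C i))" by (rule ennreal_suminf_cmult)
    finally show ?thesis .
  qed
  show ?thesis
  proof (rule ccontr)
    assume "\<not> ?thesis"
    then have "hausdorff_content ?s 1 Q = 0"
      using hausdorff_content_le_outer[of 1 ?s Q] by (simp add: zero_less_iff_neq_zero)
    then have *: "\<exists>C. Q \<subseteq> (\<Union>i. C i) \<and> (\<forall>i. bounded (C i) \<and> diameter (C i) \<le> 1) \<and>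
      (\<Sum>i. hausdorff_weight ?s (C i)) < ennreal e" if "e > 0" for e
    proof -
      have "hausdorff_content ?s 1 Q < ennreal e" using \<open>hausdorff_content ?s 1 Q = 0\<close> that by simp
      then show ?thesis unfolding hausdorff_content_def by (auto simp: Inf_less_iff)
    qed
    have "emeasure lebesgue Q' \<le> 0"
    proof (rule ennreal_le_epsilon)
      fix e :: real assume "e > 0"
      with *[of "e / \<kappa>"] \<kappa> obtain C where C: "Q \<subseteq> (\<Union>i. C i)" "\<And>i. bounded (C i)" "\<And>i. diameter (C i) \<le> 1"
        "(\<Sum>i. hausdorff_weight ?s (C i)) < ennreal (e / \<kappa>)" by auto
      have "emeasure lebesgue Q' \<le> ennreal \<kappa> * ennreal (e / \<kappa>)"
        using prism[OF C(1-3)] C(4) by (meson less_imp_le mult_left_mono order_trans zero_le)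
      also have "\<dots> = ennreal e" using \<kappa> \<open>e > 0\<close> by (simp add: ennreal_mult[symmetric])
      finally show "emeasure lebesgue Q' \<le> 0 + ennreal e" by simp
    qed
    with pos show False by simp
  qed
qed

lemma lipschitz_polyhedral_domain_faces:
  fixes S :: "'a::euclidean_space set"
  assumes "lipschitz_polyhedral_domain S"
  obtains F where "finite F" "\<And>P. P \<in> F \<Longrightarrow> polytope P"
    "\<And>P. P \<in> F \<Longrightarrow> aff_dim P = int DIM('a) - 1" "frontier S = \<Union>F"
proof -
  have "\<exists>F. finite F \<and> (\<forall>P\<in>F. polytope P \<and> aff_dim P = int DIM('a) - 1) \<and> frontier S = \<Union>F"
    using assms unfolding lipschitz_polyhedral_domain_def by (elim conjE)
  then show ?thesis using that by blast
qed

lemma surface_measure_frontier_finite: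
  fixes S :: "'a::euclidean_space set"
  assumes "lipschitz_polyhedral_domain S"
  shows "emeasure surface_measure (frontier S) < top"
proof -
  obtain F where F: "finite F" "\<And>P. P \<in> F \<Longrightarrow> polytope P" "\<And>P. P \<in> F \<Longrightarrow> aff_dim P = int DIM('a) - 1" "frontier S = \<Union>F"
    using lipschitz_polyhedral_domain_faces[OF assms] by metis
  have "emeasure surface_measure (\<Union>P\<in>F. P) \<le> (\<Sum>P\<in>F. emeasure surface_measure P)"
    using F by (intro emeasure_subadditive_finite) (auto intro!: borel_closed polytope_imp_closed)
  also have "\<dots> < top"
    unfolding ennreal_sum_less_top[OF F(1)]
  proof
    fix P assume P: "P \<in> F"
    obtain a c where "a \<noteq> 0" "P \<subseteq> {x. a \<bullet> x = c}"
      using aff_lowdim_subset_hyperplane[of P] F(3)[OF P] by auto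
    then show "emeasure surface_measure P < top"
      using hausdorff_outer_bounded_hyperplane_finite[of P a c] F(2)[OF P]
      by (simp add: emeasure_surface_measure polytope_imp_closed polytope_imp_bounded)
  qed
  finally show ?thesis by (simp add: F(4))
qed

text \<open>
  A boundary point lies on a face of codimension one, and a ball around the point cuts from that face
  a convex set of the same dimension.
\<close>

lemma surface_measure_frontier_ball_pos:
  fixes S :: "'a::euclidean_space set"
  assumes "lipschitz_polyhedral_domain S" "x \<in> frontier S" "r > 0"
  shows "emeasure surface_measure (frontier S \<inter> ball x r) > 0"
proof -
  obtain P where P: "polytope P" "aff_dim P = int DIM('a) - 1" "P \<subseteq> frontier S" "x \<in> P"
    using lipschitz_polyhedral_domain_faces[OF assms(1)] assms(2) by (metis UnionE Union_upper)
  have "x \<in> P \<inter> ball x r" using P assms(3) by simp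
  then have ne: "P \<inter> ball x r \<noteq> {}" by blast
  have "0 < hausdorff_outer (DIM('a) - 1) (P \<inter> ball x r)"
    using P ne by (intro hausdorff_outer_convex_pos)
      (auto simp: polytope_imp_convex convex_Int bounded_Int aff_dim_convex_Int_open)
  also have "\<dots> = emeasure surface_measure (P \<inter> ball x r)"
    using P by (subst emeasure_surface_measure) (auto simp: polytope_imp_closed)
  also have "\<dots> \<le> emeasure surface_measure (frontier S \<inter> ball x r)"
    using P by (intro emeasure_mono) auto
  finally show ?thesis .
qed

section \<open>Uniqueness of weak derivatives\<close>

text \<open>
  Derivatives are given by gradient vectors, so that products and compositions can be
  differentiated without handling continuous families of linear maps.
\<close>

definition C1_field :: "('a::euclidean_space \<Rightarrow> real) \<Rightarrow> bool" where
  "C1_field f \<longleftrightarrow> (\<exists>G. continuous_on UNIV G \<and> (\<forall>x. (f has_derivative (\<lambda>h. G x \<bullet> h)) (at x)))"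

lemma C1_fieldI:
  assumes "continuous_on UNIV G" "\<And>x. (f has_derivative (\<lambda>h. G x \<bullet> h)) (at x)"
  shows "C1_field f"
  using assms unfolding C1_field_def by blast

lemma C1_field_continuous: "C1_field f \<Longrightarrow> continuous_on UNIV f"
  unfolding C1_field_def by (blast intro: continuous_at_imp_continuous_on has_derivative_continuous)

lemma C1_field_const: "C1_field (\<lambda>x. c)"
  by (rule C1_fieldI[of "\<lambda>_. 0"]) auto

lemma C1_field_inner: "C1_field (\<lambda>x. x \<bullet> b)"
proof (rule C1_fieldI)
  show "((\<lambda>x. x \<bullet> b) has_derivative (\<lambda>h. b \<bullet> h)) (at x)" for x
    using bounded_linear_imp_has_derivative[OF bounded_linear_inner_left[of b]] by (simp add: inner_commute[of b])
qed auto

lemma C1_field_mult: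
  assumes "C1_field f" "C1_field g" shows "C1_field (\<lambda>x. f x * g x)"
proof -
  obtain F G where "continuous_on UNIV F" "continuous_on UNIV G"
    and der: "\<And>x. (f has_derivative (\<lambda>h. F x \<bullet> h)) (at x)" "\<And>x. (g has_derivative (\<lambda>h. G x \<bullet> h)) (at x)"
    using assms unfolding C1_field_def by blast
  then have "continuous_on UNIV (\<lambda>x. f x *\<^sub>R G x + g x *\<^sub>R F x)"
    using C1_field_continuous[OF assms(1)] C1_field_continuous[OF assms(2)] by (intro continuous_intros)
  moreover have "((\<lambda>x. f x * g x) has_derivative (\<lambda>h. (f x *\<^sub>R G x + g x *\<^sub>R F x) \<bullet> h)) (at x)" for x
    by (rule has_derivative_eq_rhs[OF has_derivative_mult[OF der]]) (auto simp: inner_add_left)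
  ultimately show ?thesis by (rule C1_fieldI)
qed

lemma C1_field_prod:
  assumes "finite I" "\<And>i. i \<in> I \<Longrightarrow> C1_field (f i)" shows "C1_field (\<lambda>x. \<Prod>i\<in>I. f i x)"
  using assms by (induction I rule: finite_induct) (auto intro!: C1_field_const C1_field_mult)

lemma C1_field_compose:
  assumes f: "C1_field f" and h: "\<And>x. (h has_real_derivative h' (f x)) (at (f x))" and h': "continuous_on (range f) h'"
  shows "C1_field (\<lambda>x. h (f x))"
proof -
  obtain F where F: "continuous_on UNIV F" "\<And>x. (f has_derivative (\<lambda>h. F x \<bullet> h)) (at x)"
    using f unfolding C1_field_def by blast
  have "continuous_on UNIV (\<lambda>x. h' (f x) *\<^sub>R F x)"
    using C1_field_continuous[OF f] F(1) by (intro continuous_intros continuous_on_compose2[OF h']) auto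
  moreover have "((\<lambda>x. h (f x)) has_derivative (\<lambda>k. (h' (f x) *\<^sub>R F x) \<bullet> k)) (at x)" for x
    using DERIV_compose_FDERIV[OF h F(2)] by (simp add: mult.commute)
  ultimately show ?thesis by (rule C1_fieldI)
qed

lemma C1_field_test_function:
  assumes "C1_field \<phi>" "compact K" "K \<subseteq> S" "\<And>x. x \<notin> K \<Longrightarrow> \<phi> x = 0"
  shows "\<exists>\<phi>'. test_function S \<phi> \<phi>'"
proof -
  obtain F where F: "continuous_on UNIV F" "\<And>x. (\<phi> has_derivative (\<lambda>h. F x \<bullet> h)) (at x)"
    using assms(1) unfolding C1_field_def by blast
  then have "test_function S \<phi> (\<lambda>x. blinfun_inner_right (F x))"
    using assms(2-) unfolding test_function_def by (auto intro!: continuous_intros)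
  then show ?thesis by blast
qed

lemma has_real_derivative_pos_part_sq:
  "((\<lambda>t::real. (max 0 t)\<^sup>2) has_real_derivative 2 * max 0 t) (at t)"
proof -
  consider "t > 0" | "t = 0" | "t < 0" by linarith
  then show ?thesis
  proof cases
    case 1
    have "((\<lambda>t. t\<^sup>2) has_real_derivative 2 * t) (at t)" by (auto intro!: derivative_eq_intros)
    then have "((\<lambda>t. (max 0 t)\<^sup>2) has_real_derivative 2 * t) (at t)"
      by (rule has_field_derivative_transform_within_open[of _ _ _ "{0<..}"]) (use 1 in auto)
    then show ?thesis using 1 by simp
  next
    case 2
    have "\<exists>g. (\<forall>z. (max 0 z)\<^sup>2 - (max 0 0)\<^sup>2 = g z * (z - 0)) \<and> isCont g 0 \<and> g 0 = (0::real)"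
      by (rule exI[of _ "max 0"]) (auto simp: max_def power2_eq_square intro!: continuous_intros)
    then show ?thesis unfolding 2 CARAT_DERIV by simp
  next
    case 3
    have "((\<lambda>t. 0) has_real_derivative 0) (at t)" by simp
    then have "((\<lambda>t. (max 0 t)\<^sup>2) has_real_derivative 0) (at t)"
      by (rule has_field_derivative_transform_within_open[of _ _ _ "{..<0}"]) (use 3 in auto)
    then show ?thesis using 3 by simp
  qed
qed

text \<open>
  The function is positive exactly on the open box with corners \<open>c\<close> and \<open>d\<close>.
\<close>

lemma C1_field_bump:
  "C1_field (\<lambda>x. \<Prod>b\<in>Basis. (max 0 (x \<bullet> b - c \<bullet> b))\<^sup>2 * (max 0 (d \<bullet> b - x \<bullet> b))\<^sup>2)"
proof (intro C1_field_prod C1_field_mult)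
  fix b :: 'a
  have C: "C1_field (\<lambda>x. x \<bullet> b - c \<bullet> b)" "C1_field (\<lambda>x. d \<bullet> b - x \<bullet> b)"
    by (rule C1_field_compose[OF C1_field_inner[of b], of "\<lambda>t. t - c \<bullet> b" "\<lambda>_. 1"]
        C1_field_compose[OF C1_field_inner[of b], of "\<lambda>t. d \<bullet> b - t" "\<lambda>_. - 1"];
        auto intro!: derivative_eq_intros)+
  show "C1_field (\<lambda>x. (max 0 (x \<bullet> b - c \<bullet> b))\<^sup>2)"
    by (rule C1_field_compose[OF C(1) has_real_derivative_pos_part_sq]) (intro continuous_intros)
  show "C1_field (\<lambda>x. (max 0 (d \<bullet> b - x \<bullet> b))\<^sup>2)"
    by (rule C1_field_compose[OF C(2) has_real_derivative_pos_part_sq]) (intro continuous_intros)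
qed auto

lemma borel_measurable_lebesgue_continuous:
  fixes f :: "'a::euclidean_space \<Rightarrow> 'b::real_normed_vector"
  shows "continuous_on UNIV f \<Longrightarrow> f \<in> borel_measurable lebesgue"
  by (intro measurable_completion) (simp add: borel_measurable_continuous_onI)

text \<open>
  If \<open>m\<close> is the bump of the box, the test functions \<open>n m / (1 + n m)\<close> stay between 0 and 1 and tend
  to the indicator of the box.
\<close>

lemma box_integral_zero_of_test_functions:
  fixes f :: "'a::euclidean_space \<Rightarrow> complex"
  assumes f: "locally_integrable S f"
    and zero: "\<And>\<phi> \<phi>'. test_function S \<phi> \<phi>' \<Longrightarrow> (LINT x:S|lebesgue. f x * of_real (\<phi> x)) = 0"
    and sub: "cbox c d \<subseteq> S"
  shows "(LINT x:box c d|lebesgue. f x) = 0"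
proof -
  define m where "m x = (\<Prod>b\<in>Basis. (max 0 (x \<bullet> b - c \<bullet> b))\<^sup>2 * (max 0 (d \<bullet> b - x \<bullet> b))\<^sup>2)" for x
  have m0: "m x \<ge> 0" for x unfolding m_def by (intro prod_nonneg) auto
  have m_pos: "m x > 0 \<longleftrightarrow> x \<in> box c d" for x
  proof
    assume "x \<in> box c d" then show "m x > 0" unfolding m_def mem_box by (intro prod_pos) auto
  next
    assume "m x > 0"
    then have "m x \<noteq> 0" by simp
    then have "\<forall>b\<in>Basis. (max 0 (x \<bullet> b - c \<bullet> b))\<^sup>2 * (max 0 (d \<bullet> b - x \<bullet> b))\<^sup>2 \<noteq> 0"
      unfolding m_def by (simp add: prod_zero_iff)
    then show "x \<in> box c d" unfolding mem_box by (force simp: max_def split: if_splits)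
  qed
  have mC1: "C1_field m" using C1_field_bump[of c d] unfolding m_def .
  define \<phi> where "\<phi> n x = real n * m x * inverse (1 + real n * m x)" for n x
  have den: "1 + real n * m x > 0" for n x using m0[of x] by (simp add: add_pos_nonneg)
  have \<phi>C1: "C1_field (\<phi> n)" for n
  proof -
    have "C1_field (\<lambda>x. inverse (1 + real n * m x))"
    proof (rule C1_field_compose[OF mC1, of "\<lambda>t. inverse (1 + real n * t)" "\<lambda>t. - real n / (1 + real n * t)\<^sup>2"])
      show "((\<lambda>t. inverse (1 + real n * t)) has_real_derivative - real n / (1 + real n * m x)\<^sup>2) (at (m x))" for x
        using den[of n x] by (auto intro!: derivative_eq_intros simp: power2_eq_square field_simps)
      show "continuous_on (range m) (\<lambda>t. - real n / (1 + real n * t)\<^sup>2)"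
        using den by (intro continuous_intros) (auto simp: less_imp_neq[symmetric])
    qed
    then show ?thesis unfolding \<phi>_def by (intro C1_field_mult C1_field_const mC1)
  qed
  have \<phi>_zero: "\<phi> n x = 0" if "x \<notin> box c d" for n x
    using m_pos[of x] m0[of x] that by (simp add: \<phi>_def)
  have \<phi>_range: "0 \<le> \<phi> n x" "\<phi> n x \<le> 1" for n x
    using den[of n x] m0[of x] by (auto simp: \<phi>_def field_simps)
  have \<phi>_lim: "(\<lambda>n. \<phi> n x) \<longlonglongrightarrow> indicator (box c d) x" for x
  proof (cases "x \<in> box c d")
    case True
    then have pos: "m x > 0" using m_pos by simp
    have "filterlim (\<lambda>n. m x * real n) at_top sequentially"
      by (rule filterlim_tendsto_pos_mult_at_top[OF tendsto_const pos filterlim_real_sequentially])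
    then have "filterlim (\<lambda>n. 1 + real n * m x) at_top sequentially"
      by (intro filterlim_tendsto_add_at_top[OF tendsto_const]) (simp add: mult.commute)
    then have "(\<lambda>n. 1 - inverse (1 + real n * m x)) \<longlonglongrightarrow> 1 - 0"
      by (intro tendsto_diff tendsto_const tendsto_inverse_0_at_top)
    moreover have "1 - inverse (1 + real n * m x) = \<phi> n x" for n
      using den[of n x] by (simp add: \<phi>_def field_simps)
    ultimately show ?thesis using True by simp
  qed (simp add: \<phi>_zero)
  have int: "integrable lebesgue (\<lambda>x. indicator (cbox c d) x *\<^sub>R f x)"
    using f sub compact_cbox unfolding locally_integrable_def set_integrable_def by blast
  then have meas: "(\<lambda>x. indicator (cbox c d) x *\<^sub>R f x) \<in> borel_measurable lebesgue" by simp
  have eq: "indicator S x *\<^sub>R (f x * of_real (\<phi> n x)) = (indicator (cbox c d) x *\<^sub>R f x) * of_real (\<phi> n x)" for n x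
  proof (cases "x \<in> box c d")
    case True
    then have "x \<in> cbox c d" "x \<in> S" using sub box_subset_cbox[of c d] by blast+
    then show ?thesis by simp
  qed (simp add: \<phi>_zero)
  have "(\<lambda>n. \<integral>x. (indicator (cbox c d) x *\<^sub>R f x) * of_real (\<phi> n x) \<partial>lebesgue)
      \<longlonglongrightarrow> (\<integral>x. (indicator (cbox c d) x *\<^sub>R f x) * of_real (indicator (box c d) x) \<partial>lebesgue)"
  proof (rule integral_dominated_convergence[of _ _ _ "\<lambda>x. norm (indicator (cbox c d) x *\<^sub>R f x)"])
    show "(\<lambda>x. indicator (cbox c d) x *\<^sub>R f x * complex_of_real (\<phi> n x)) \<in> borel_measurable lebesgue" for n
      using C1_field_continuous[OF \<phi>C1, of n]
      by (intro borel_measurable_times meas borel_measurable_lebesgue_continuous continuous_intros)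
    have "(indicator (box c d) :: 'a \<Rightarrow> real) \<in> borel_measurable lebesgue"
      by (rule borel_measurable_indicator) simp
    then show "(\<lambda>x. indicator (cbox c d) x *\<^sub>R f x * complex_of_real (indicator (box c d) x)) \<in> borel_measurable lebesgue"
      by (intro borel_measurable_times meas measurable_compose[OF _ borel_measurable_continuous_onI[OF continuous_on_of_real_id]])
    show "AE x in lebesgue. (\<lambda>n. indicator (cbox c d) x *\<^sub>R f x * complex_of_real (\<phi> n x))
        \<longlonglongrightarrow> indicator (cbox c d) x *\<^sub>R f x * complex_of_real (indicator (box c d) x)"
      by (intro AE_I2 tendsto_intros \<phi>_lim)
    show "AE x in lebesgue. norm (indicator (cbox c d) x *\<^sub>R f x * complex_of_real (\<phi> n x))
        \<le> norm (indicator (cbox c d) x *\<^sub>R f x)" for n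
      unfolding norm_mult norm_of_real using \<phi>_range[of n] by (intro AE_I2 mult_right_le_one_le) auto
  qed (use int in \<open>rule integrable_norm\<close>)
  moreover have "(\<integral>x. (indicator (cbox c d) x *\<^sub>R f x) * of_real (\<phi> n x) \<partial>lebesgue) = 0" for n
  proof -
    have "box c d \<subseteq> cbox c d" by (rule box_subset_cbox)
    then obtain \<phi>' where "test_function S (\<phi> n) \<phi>'"
      using C1_field_test_function[OF \<phi>C1 compact_cbox sub, of n] \<phi>_zero by blast
    from zero[OF this] show ?thesis unfolding set_lebesgue_integral_def eq .
  qed
  ultimately have "(\<lambda>n. 0) \<longlonglongrightarrow> (\<integral>x. (indicator (cbox c d) x *\<^sub>R f x) * of_real (indicator (box c d) x) \<partial>lebesgue)"
    by (simp only:)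
  then have "0 = (\<integral>x. (indicator (cbox c d) x *\<^sub>R f x) * of_real (indicator (box c d) x) \<partial>lebesgue)"
    by (rule LIMSEQ_unique[OF tendsto_const])
  also have "\<dots> = (\<integral>x. indicator (box c d) x *\<^sub>R f x \<partial>lebesgue)"
    using box_subset_cbox[of c d] by (intro Bochner_Integration.integral_cong) (auto split: split_indicator)
  finally show ?thesis by (simp add: set_lebesgue_integral_def)
qed

text \<open>
  Boxes are stable under intersection and generate the Borel sets, so the integral vanishes over
  every Borel set. A function measurable for the completed measure is first replaced by a Borel one.
\<close>

lemma AE_zero_of_box_integrals:
  fixes F :: "'a::euclidean_space \<Rightarrow> complex"
  assumes F: "integrable lebesgue F" and zero: "\<And>a b. (LINT x:box a b|lebesgue. F x) = 0"
  shows "AE x in lebesgue. F x = 0"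
proof -
  have "F \<in> borel_measurable lebesgue" using F by simp
  then have "(\<lambda>x. Re (F x)) \<in> borel_measurable lebesgue" "(\<lambda>x. Im (F x)) \<in> borel_measurable lebesgue"
    by simp_all
  then obtain R I where R: "R \<in> borel_measurable lborel" "AE x in lborel. Re (F x) = R x"
    and I: "I \<in> borel_measurable lborel" "AE x in lborel. Im (F x) = I x"
    using completion_ex_borel_measurable_real by metis
  define G where "G x = Complex (R x) (I x)" for x
  have G [measurable]: "G \<in> borel_measurable lborel"
    unfolding G_def Complex_eq using R(1) I(1) by measurable
  have FG': "AE x in lborel. F x = G x"
    using R(2) I(2) by eventually_elim (simp add: G_def complex_eq_iff)
  then have FG: "AE x in lebesgue. F x = G x" by (rule AE_completion)
  have Gleb: "G \<in> borel_measurable lebesgue" using G by (rule measurable_completion)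
  have "integrable lebesgue G"
    using F FG Gleb by (subst integrable_cong_AE[of G _ F]) (auto elim: AE_mp)
  then have iG: "integrable lborel G" using G by (simp add: integrable_completion)
  have set_int: "integrable lborel (\<lambda>x. indicator A x *\<^sub>R G x)" if "A \<in> sets borel" for A
    using that by (intro integrable_mult_indicator iG) simp
  have boxes: "(LINT x:box a b|lborel. G x) = 0" for a b
  proof -
    have "(LINT x:box a b|lborel. G x) = (LINT x:box a b|lebesgue. G x)"
      unfolding set_lebesgue_integral_def by (rule integral_completion[symmetric]) measurable
    also have "\<dots> = (LINT x:box a b|lebesgue. F x)"
      unfolding set_lebesgue_integral_def
    proof (rule integral_cong_AE)
      show "AE x in lebesgue. indicat_real (box a b) x *\<^sub>R G x = indicat_real (box a b) x *\<^sub>R F x"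
        using FG by eventually_elim simp
    qed (use F Gleb in \<open>auto intro!: borel_measurable_scaleR borel_measurable_indicator\<close>)
    finally show ?thesis using zero by simp
  qed
  have UNIV0: "integral\<^sup>L lborel G = 0"
  proof -
    let ?B = "\<lambda>n::nat. box (- (real n *\<^sub>R One)) (real n *\<^sub>R One) :: 'a set"
    have "(\<lambda>n. LINT x|lborel. indicator (?B n) x *\<^sub>R G x) \<longlonglongrightarrow> (LINT x|lborel. G x)"
    proof (rule integral_dominated_convergence[of _ _ _ "\<lambda>x. norm (G x)"])
      show "AE x in lborel. (\<lambda>n. indicator (?B n) x *\<^sub>R G x) \<longlonglongrightarrow> G x"
      proof (intro AE_I2 tendsto_eventually)
        fix x :: 'a
        obtain N :: nat where N: "norm x < real N" using reals_Archimedean2 by blast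
        have "x \<in> ?B n" if "n \<ge> N" for n
        proof -
          have "\<bar>x \<bullet> i\<bar> < real n" if "i \<in> Basis" for i
            using Basis_le_norm[OF that, of x] N \<open>n \<ge> N\<close> by linarith
          then show ?thesis by (auto simp: mem_box abs_less_iff minus_less_iff)
        qed
        then show "\<forall>\<^sub>F n in sequentially. indicator (?B n) x *\<^sub>R G x = G x"
          by (intro eventually_sequentiallyI[of N]) simp
      qed
    qed (use iG in \<open>auto split: split_indicator\<close>)
    moreover have "(LINT x|lborel. indicator (?B n) x *\<^sub>R G x) = 0" for n
      using boxes unfolding set_lebesgue_integral_def .
    ultimately show ?thesis by (simp add: LIMSEQ_const_iff)
  qed
  let ?E = "range (\<lambda>(a, b). box a b :: 'a set)"
  have all: "(LINT x:A|lborel. G x) = 0" if "A \<in> sets borel" for A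
  proof -
    have borel: "sigma_sets UNIV ?E = sets borel" by (simp add: borel_eq_box)
    have "Int_stable ?E" by (auto simp: Int_stable_def box_Int_box)
    moreover have "?E \<subseteq> Pow UNIV" by simp
    moreover have "A \<in> sigma_sets UNIV ?E" using that borel by simp
    ultimately show ?thesis
    proof (induction rule: sigma_sets_induct_disjoint)
      case (basic A) then show ?case using boxes by auto
    next
      case empty show ?case by (simp add: set_lebesgue_integral_def)
    next
      case (compl A)
      then have A: "A \<in> sets borel" using borel by simp
      have "(LINT x:UNIV - A|lborel. G x) = (LINT x|lborel. G x - indicator A x *\<^sub>R G x)"
        unfolding set_lebesgue_integral_def by (intro Bochner_Integration.integral_cong) (auto split: split_indicator)
      also have "\<dots> = 0"
        using compl UNIV0 iG set_int[OF A] by (simp add: set_lebesgue_integral_def)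
      finally show ?case .
    next
      case (union A)
      then have A: "A i \<in> sets borel" for i using borel by auto
      then have "(\<Union>i. A i) \<in> sets borel" by auto
      then have "(LINT x:(\<Union>i. A i)|lborel. G x) = (\<Sum>i. LINT x:A i|lborel. G x)"
        using A union(1) set_int by (intro lebesgue_integral_countable_add) (auto simp: disjoint_family_on_def set_integrable_def)
      then show ?case using union by simp
    qed
  qed
  have "AE x in lborel. G x = 0"
    by (rule sigma_finite_measure.density_zero[OF sigma_finite_lborel iG]) (simp add: all)
  with FG' have "AE x in lborel. F x = 0" by eventually_elim simp
  then show ?thesis by (rule AE_completion)
qed

text \<open>
  The fundamental lemma of the calculus of variations: an open set is a countable union of closed
  boxes.
\<close>

lemma AE_zero_of_test_functions:
  fixes f :: "'a::euclidean_space \<Rightarrow> complex"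
  assumes S: "open S" and f: "locally_integrable S f"
    and zero: "\<And>\<phi> \<phi>'. test_function S \<phi> \<phi>' \<Longrightarrow> (LINT x:S|lebesgue. f x * of_real (\<phi> x)) = 0"
  shows "AE x in lebesgue. x \<in> S \<longrightarrow> f x = 0"
proof -
  have one: "AE x in lebesgue. x \<in> cbox c d \<longrightarrow> f x = 0" if sub: "cbox c d \<subseteq> S" for c d
  proof -
    have "integrable lebesgue (\<lambda>x. indicator (cbox c d) x *\<^sub>R f x)"
      using f sub compact_cbox unfolding locally_integrable_def set_integrable_def by blast
    then have "integrable lebesgue (\<lambda>x. indicator (box c d) x *\<^sub>R (indicator (cbox c d) x *\<^sub>R f x))"
      by (rule integrable_mult_indicator[rotated]) simp
    moreover have "indicator (box c d) x *\<^sub>R (indicator (cbox c d) x *\<^sub>R f x) = indicator (box c d) x *\<^sub>R f x" for x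
      using box_subset_cbox[of c d] by (auto split: split_indicator)
    ultimately have int: "integrable lebesgue (\<lambda>x. indicator (box c d) x *\<^sub>R f x)" by (simp only:)
    have "AE x in lebesgue. indicator (box c d) x *\<^sub>R f x = 0"
    proof (rule AE_zero_of_box_integrals[OF int])
      fix a b :: 'a
      obtain e g where eg: "box a b \<inter> box c d = box e g" using box_Int_box by blast
      have "(LINT x:box a b|lebesgue. indicator (box c d) x *\<^sub>R f x) = (LINT x:box e g|lebesgue. f x)"
        unfolding set_lebesgue_integral_def eg[symmetric] by (simp add: indicator_inter_arith)
      also have "\<dots> = 0"
      proof (cases "box e g = {}")
        case False
        have "cbox e g = closure (box e g)" using False by simp
        also have "\<dots> \<subseteq> closure (cbox c d)"
          by (rule closure_mono) (use eg box_subset_cbox in blast)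
        finally have "cbox e g \<subseteq> S" using sub by simp
        then show ?thesis by (intro box_integral_zero_of_test_functions[OF f zero])
      qed (simp add: set_lebesgue_integral_def)
      finally show "(LINT x:box a b|lebesgue. indicator (box c d) x *\<^sub>R f x) = 0" .
    qed
    moreover have "AE x in lebesgue. x \<notin> cbox c d - box c d"
      using negligible_frontier_interval[of c d] by (intro AE_not_in) (simp add: negligible_iff_null_sets)
    ultimately show ?thesis by eventually_elim auto
  qed
  obtain D where D: "countable D" "\<And>X. X \<in> D \<Longrightarrow> X \<subseteq> S" "\<And>X. X \<in> D \<Longrightarrow> \<exists>a b. X = cbox a b" "\<Union>D = S"
    using open_countable_Union_open_cbox[OF S] by (metis Pow_iff subsetD)
  have "AE x in lebesgue. \<forall>X\<in>D. x \<in> X \<longrightarrow> f x = 0"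
    unfolding AE_ball_countable[OF D(1)] using one D(2,3) by blast
  then show ?thesis by eventually_elim (use D(4) in auto)
qed

lemma set_integrable_times_test:
  fixes f :: "'a::euclidean_space \<Rightarrow> complex" and \<psi> :: "'a \<Rightarrow> real"
  assumes f: "locally_integrable S f" and K: "compact K" "K \<subseteq> S"
    and \<psi>: "continuous_on UNIV \<psi>" "\<And>x. x \<notin> K \<Longrightarrow> \<psi> x = 0"
  shows "set_integrable lebesgue S (\<lambda>x. f x * of_real (\<psi> x))"
proof -
  have int: "integrable lebesgue (\<lambda>x. indicator K x *\<^sub>R f x)"
    using f K unfolding locally_integrable_def set_integrable_def by blast
  have "compact (\<psi> ` K)" using K(1) \<psi>(1) by (meson compact_continuous_image continuous_on_subset top_greatest)
  then obtain B where B: "\<And>x. x \<in> K \<Longrightarrow> \<bar>\<psi> x\<bar> \<le> B" using compact_imp_bounded[of "\<psi> ` K"] unfolding bounded_iff by auto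
  have "integrable lebesgue (\<lambda>x. (indicator K x *\<^sub>R f x) * of_real (\<psi> x))"
  proof (rule Bochner_Integration.integrable_bound[OF integrable_mult_right[OF integrable_norm[OF int], of B]])
    show "(\<lambda>x. indicator K x *\<^sub>R f x * complex_of_real (\<psi> x)) \<in> borel_measurable lebesgue"
      using borel_measurable_integrable[OF int] borel_measurable_lebesgue_continuous[OF \<psi>(1)]
      by (intro borel_measurable_times measurable_compose[OF _ borel_measurable_continuous_onI[OF continuous_on_of_real_id]])
    show "AE x in lebesgue. norm (indicator K x *\<^sub>R f x * complex_of_real (\<psi> x)) \<le> norm (B * norm (indicator K x *\<^sub>R f x))"
    proof (intro AE_I2)
      fix x
      show "norm (indicator K x *\<^sub>R f x * complex_of_real (\<psi> x)) \<le> norm (B * norm (indicator K x *\<^sub>R f x))"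
      proof (cases "x \<in> K")
        case True
        then have "norm (f x) * \<bar>\<psi> x\<bar> \<le> norm (f x) * \<bar>B\<bar>" using B[OF True] by (intro mult_left_mono) auto
        then show ?thesis using True by (simp add: norm_mult abs_mult mult.commute)
      qed simp
    qed
  qed
  moreover have "(indicator K x *\<^sub>R f x) * of_real (\<psi> x) = indicator S x *\<^sub>R (f x * of_real (\<psi> x))" for x
    using K(2) \<psi>(2)[of x] by (cases "x \<in> K") auto
  ultimately show ?thesis by (simp only: set_integrable_def)
qed

lemma test_function_support:
  assumes "test_function S \<phi> \<phi>'"
  obtains K where "compact K" "K \<subseteq> S" "\<And>x. x \<notin> K \<Longrightarrow> \<phi> x = 0" "\<And>x. x \<notin> K \<Longrightarrow> \<phi>' x = 0"
    "continuous_on UNIV \<phi>" "\<And>b. continuous_on UNIV (\<lambda>x. blinfun_apply (\<phi>' x) b)"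
proof -
  obtain K where K: "compact K" "K \<subseteq> S" "\<And>x. x \<notin> K \<Longrightarrow> \<phi> x = 0"
    using assms unfolding test_function_def by blast
  have der: "\<And>x. (\<phi> has_derivative blinfun_apply (\<phi>' x)) (at x)" and cont: "continuous_on UNIV \<phi>'"
    using assms unfolding test_function_def by auto
  have "\<phi>' x = 0" if "x \<notin> K" for x
  proof -
    have "((\<lambda>x. 0) has_derivative blinfun_apply (\<phi>' x)) (at x)"
      using K that by (intro has_derivative_transform_within_open[OF der, where s = "- K"])
        (auto simp: compact_imp_closed open_Compl)
    then have "blinfun_apply (\<phi>' x) = (\<lambda>h. 0)"
      using has_derivative_unique[OF _ has_derivative_const] by blast
    then show ?thesis by (intro blinfun_eqI) simp
  qed
  moreover have "continuous_on UNIV \<phi>"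
    using der by (meson continuous_at_imp_continuous_on has_derivative_continuous)
  ultimately show ?thesis using that[OF K] cont by (simp add: continuous_intros)
qed

lemma set_integrable_test_function:
  fixes f :: "'a::euclidean_space \<Rightarrow> complex"
  assumes "locally_integrable S f" "test_function S \<phi> \<phi>'"
  shows "set_integrable lebesgue S (\<lambda>x. f x * of_real (\<phi> x))"
    and "set_integrable lebesgue S (\<lambda>x. f x * of_real (blinfun_apply (\<phi>' x) b))"
proof -
  obtain K where K: "compact K" "K \<subseteq> S" "\<And>x. x \<notin> K \<Longrightarrow> \<phi> x = 0" "\<And>x. x \<notin> K \<Longrightarrow> \<phi>' x = 0"
    "continuous_on UNIV \<phi>" "\<And>b. continuous_on UNIV (\<lambda>x. blinfun_apply (\<phi>' x) b)"
    using test_function_support[OF assms(2)] by blast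
  show "set_integrable lebesgue S (\<lambda>x. f x * of_real (\<phi> x))"
    by (rule set_integrable_times_test[OF assms(1) K(1,2,5,3)])
  show "set_integrable lebesgue S (\<lambda>x. f x * of_real (blinfun_apply (\<phi>' x) b))"
    by (rule set_integrable_times_test[OF assms(1) K(1,2,6)]) (simp add: K(4))
qed

lemma locally_integrable_lincomb:
  assumes "locally_integrable S f" "locally_integrable S g"
  shows "locally_integrable S (\<lambda>x. f x + c * g x)"
  using assms unfolding locally_integrable_def by (auto intro!: set_integral_add set_integrable_mult_right)

lemma weak_pderiv_unique:
  fixes u :: "'a::euclidean_space \<Rightarrow> complex"
  assumes S: "open S" and g: "has_weak_pderiv S b u g" and h: "has_weak_pderiv S b u h"
  shows "AE x in lebesgue. x \<in> S \<longrightarrow> g x = h x"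
proof -
  have loc: "locally_integrable S g" "locally_integrable S h"
    using g h unfolding has_weak_pderiv_def by auto
  have "AE x in lebesgue. x \<in> S \<longrightarrow> g x + (- 1) * h x = 0"
  proof (rule AE_zero_of_test_functions[OF S locally_integrable_lincomb[OF loc]])
    fix \<phi> \<phi>' assume \<phi>: "test_function S \<phi> \<phi>'"
    have "(LINT x:S|lebesgue. (g x + (- 1) * h x) * of_real (\<phi> x))
        = (LINT x:S|lebesgue. g x * of_real (\<phi> x) - h x * of_real (\<phi> x))"
      by (simp add: algebra_simps)
    also have "\<dots> = 0"
      using g h \<phi> unfolding has_weak_pderiv_def
      by (subst set_integral_diff) (auto intro!: set_integrable_test_function loc \<phi>)
    finally show "(LINT x:S|lebesgue. (g x + (- 1) * h x) * of_real (\<phi> x)) = 0" .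
  qed
  then show ?thesis by eventually_elim auto
qed

text \<open>
  The representative of the weak derivative is chosen arbitrarily. This is what allows one to
  compute with it: it agrees almost everywhere with any weak derivative that is known explicitly.
\<close>

lemma weak_pderiv_AE:
  assumes "open S" "has_weak_pderiv S b u g"
  shows "AE x in lebesgue. x \<in> S \<longrightarrow> weak_pderiv S b u x = g x"
  using weak_pderiv_unique[OF assms(1) _ assms(2)] someI[of "has_weak_pderiv S b u", OF assms(2)]
  unfolding weak_pderiv_def by blast

lemma has_weak_pderiv_lincomb:
  fixes u v :: "'a::euclidean_space \<Rightarrow> complex"
  assumes g: "has_weak_pderiv S b u g" and h: "has_weak_pderiv S b v h"
  shows "has_weak_pderiv S b (\<lambda>x. u x + c * v x) (\<lambda>x. g x + c * h x)"
  unfolding has_weak_pderiv_def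
proof (intro conjI allI impI)
  have loc: "locally_integrable S g" "locally_integrable S h" "locally_integrable S u" "locally_integrable S v"
    using g h unfolding has_weak_pderiv_def by auto
  then show "locally_integrable S (\<lambda>x. u x + c * v x)" "locally_integrable S (\<lambda>x. g x + c * h x)"
    by (auto intro: locally_integrable_lincomb)
  fix \<phi> \<phi>' assume \<phi>: "test_function S \<phi> \<phi>'"
  note int = set_integrable_test_function[OF _ \<phi>]
  have dist: "(x + c * y) * z = x * z + c * (y * z)" for x y z :: complex by (simp add: algebra_simps)
  have "(LINT x:S|lebesgue. (u x + c * v x) * of_real (blinfun_apply (\<phi>' x) b))
      = (LINT x:S|lebesgue. u x * of_real (blinfun_apply (\<phi>' x) b))
        + c * (LINT x:S|lebesgue. v x * of_real (blinfun_apply (\<phi>' x) b))"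
    unfolding dist by (subst set_integral_add) (auto intro!: int loc set_integrable_mult_right)
  also have "\<dots> = - ((LINT x:S|lebesgue. g x * of_real (\<phi> x)) + c * (LINT x:S|lebesgue. h x * of_real (\<phi> x)))"
    using g h \<phi> unfolding has_weak_pderiv_def by (simp add: algebra_simps)
  also have "(LINT x:S|lebesgue. g x * of_real (\<phi> x)) + c * (LINT x:S|lebesgue. h x * of_real (\<phi> x))
      = (LINT x:S|lebesgue. (g x + c * h x) * of_real (\<phi> x))"
    unfolding dist by (subst set_integral_add) (auto intro!: int loc set_integrable_mult_right)
  finally show "(LINT x:S|lebesgue. (u x + c * v x) * of_real (blinfun_apply (\<phi>' x) b))
      = - (LINT x:S|lebesgue. (g x + c * h x) * of_real (\<phi> x))" .
qed

section \<open>Weak derivatives of piecewise smooth functions\<close>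

text \<open>
  Continuity is part of the predicate because it provides the bounds on compact sets that the
  Lipschitz estimates need.
\<close>

definition has_dir_deriv :: "'a::euclidean_space \<Rightarrow> ('a \<Rightarrow> complex) \<Rightarrow> ('a \<Rightarrow> complex) \<Rightarrow> bool" where
  "has_dir_deriv b P Q \<longleftrightarrow> continuous_on UNIV P \<and> continuous_on UNIV Q \<and>
     (\<forall>x t. ((\<lambda>s. P (x + s *\<^sub>R b)) has_vector_derivative Q (x + t *\<^sub>R b)) (at t))"

lemma has_dir_deriv_const: "has_dir_deriv b (\<lambda>x. c) (\<lambda>x. 0)"
  unfolding has_dir_deriv_def by auto

lemma has_dir_deriv_mult:
  assumes "has_dir_deriv b P Q" "has_dir_deriv b P' Q'"
  shows "has_dir_deriv b (\<lambda>x. P x * P' x) (\<lambda>x. P x * Q' x + Q x * P' x)"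
  using assms unfolding has_dir_deriv_def by (auto intro!: continuous_intros has_vector_derivative_mult)

lemma has_dir_deriv_sum:
  assumes "\<And>i. i \<in> I \<Longrightarrow> has_dir_deriv b (P i) (Q i)"
  shows "has_dir_deriv b (\<lambda>x. \<Sum>i\<in>I. P i x) (\<lambda>x. \<Sum>i\<in>I. Q i x)"
  using assms unfolding has_dir_deriv_def by (auto intro!: continuous_intros has_vector_derivative_sum)

lemma has_dir_deriv_inner: "has_dir_deriv b (\<lambda>x. of_real (x \<bullet> c)) (\<lambda>x. of_real (b \<bullet> c))"
  unfolding has_dir_deriv_def inner_add_left inner_scaleR_left
  by (auto intro!: continuous_intros has_vector_derivative_of_real derivative_eq_intros)

lemma has_dir_deriv_power:
  assumes "has_dir_deriv b P Q" shows "\<exists>R. has_dir_deriv b (\<lambda>x. P x ^ n) R"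
proof (induction n)
  case 0 show ?case using has_dir_deriv_const[of b 1] by auto
next
  case (Suc n) then show ?case using has_dir_deriv_mult[OF assms] by fastforce
qed

lemma has_dir_deriv_prod:
  assumes "finite I" "\<And>i. i \<in> I \<Longrightarrow> \<exists>Q. has_dir_deriv b (P i) Q"
  shows "\<exists>R. has_dir_deriv b (\<lambda>x. \<Prod>i\<in>I. P i x) R"
  using assms
proof (induction I rule: finite_induct)
  case empty show ?case using has_dir_deriv_const[of b 1] by auto
next
  case (insert i I)
  obtain Q where "has_dir_deriv b (P i) Q" using insert.prems[of i] by blast
  moreover obtain R where "has_dir_deriv b (\<lambda>x. \<Prod>i\<in>I. P i x) R"
    using insert.IH insert.prems by blast
  ultimately show ?case using has_dir_deriv_mult insert(1,2) by fastforce
qed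

lemma poly_total_degree_has_dir_deriv:
  assumes "poly_total_degree_le p P" shows "\<exists>Q. has_dir_deriv b P Q"
proof -
  let ?A = "{\<alpha> \<in> Basis \<rightarrow>\<^sub>E {..p}. (\<Sum>b\<in>Basis. \<alpha> b) \<le> p} :: ('a \<Rightarrow> nat) set"
  obtain c where c: "\<And>x. P x = (\<Sum>\<alpha>\<in>?A. c \<alpha> * of_real (\<Prod>b\<in>Basis. (x \<bullet> b) ^ \<alpha> b))"
    using assms unfolding poly_total_degree_le_def by blast
  have "\<exists>R. has_dir_deriv b (\<lambda>x. c \<alpha> * of_real (\<Prod>b\<in>Basis. (x \<bullet> b) ^ \<alpha> b)) R" for \<alpha> :: "'a \<Rightarrow> nat"
  proof -
    have "\<exists>R. has_dir_deriv b (\<lambda>x. \<Prod>b\<in>Basis. of_real (x \<bullet> b) ^ \<alpha> b) R"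
      by (intro has_dir_deriv_prod has_dir_deriv_power[OF has_dir_deriv_inner]) auto
    then obtain R where "has_dir_deriv b (\<lambda>x. \<Prod>b\<in>Basis. of_real (x \<bullet> b) ^ \<alpha> b) R" ..
    from has_dir_deriv_mult[OF has_dir_deriv_const this] show ?thesis by auto
  qed
  then obtain R where "\<And>\<alpha>. has_dir_deriv b (\<lambda>x. c \<alpha> * of_real (\<Prod>b\<in>Basis. (x \<bullet> b) ^ \<alpha> b)) (R \<alpha>)"
    by metis
  then have "has_dir_deriv b (\<lambda>x. \<Sum>\<alpha>\<in>?A. c \<alpha> * of_real (\<Prod>b\<in>Basis. (x \<bullet> b) ^ \<alpha> b)) (\<lambda>x. \<Sum>\<alpha>\<in>?A. R \<alpha> x)"
    by (intro has_dir_deriv_sum) auto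
  then show ?thesis using c by (metis (no_types, lifting) ext)
qed

lemma test_function_has_dir_deriv:
  assumes "test_function S \<phi> \<phi>'"
  shows "has_dir_deriv b (\<lambda>x. of_real (\<phi> x)) (\<lambda>x. of_real (blinfun_apply (\<phi>' x) b))"
  unfolding has_dir_deriv_def
proof (intro conjI allI)
  obtain K where "continuous_on UNIV \<phi>" "\<And>b. continuous_on UNIV (\<lambda>x. blinfun_apply (\<phi>' x) b)"
    using test_function_support[OF assms] by blast
  then show "continuous_on UNIV (\<lambda>x. complex_of_real (\<phi> x))"
    "continuous_on UNIV (\<lambda>x. complex_of_real (blinfun_apply (\<phi>' x) b))"
    by (auto intro: continuous_on_of_real)
  fix x t
  have "(\<phi> has_derivative blinfun_apply (\<phi>' (x + t *\<^sub>R b))) (at (x + t *\<^sub>R b))"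
    using assms unfolding test_function_def by blast
  moreover have "((\<lambda>s. x + s *\<^sub>R b) has_derivative (\<lambda>h. h *\<^sub>R b)) (at t)"
    by (auto intro!: derivative_eq_intros)
  ultimately have "((\<lambda>s. \<phi> (x + s *\<^sub>R b)) has_derivative (\<lambda>h. blinfun_apply (\<phi>' (x + t *\<^sub>R b)) (h *\<^sub>R b))) (at t)"
    by (rule has_derivative_compose[rotated])
  then have "((\<lambda>s. \<phi> (x + s *\<^sub>R b)) has_real_derivative blinfun_apply (\<phi>' (x + t *\<^sub>R b)) b) (at t)"
    unfolding has_field_derivative_def by (simp add: blinfun.scaleR_right mult_commute_abs)
  then show "((\<lambda>s. complex_of_real (\<phi> (x + s *\<^sub>R b))) has_vector_derivative
      complex_of_real (blinfun_apply (\<phi>' (x + t *\<^sub>R b)) b)) (at t)"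
    by (rule has_vector_derivative_of_real)
qed

lemma has_dir_deriv_difference_quotient:
  assumes "has_dir_deriv b P Q"
  shows "(\<lambda>n. real (Suc n) *\<^sub>R (P (x + (1 / real (Suc n)) *\<^sub>R b) - P x)) \<longlonglongrightarrow> Q x"
proof -
  let ?f = "\<lambda>s. P (x + s *\<^sub>R b)"
  have "(?f has_vector_derivative Q (x + 0 *\<^sub>R b)) (at 0)"
    using assms unfolding has_dir_deriv_def by blast
  then have "((\<lambda>y. norm ((?f y - ?f 0) - (y - 0) *\<^sub>R Q x) / norm (y - 0)) \<longlongrightarrow> 0) (at 0)"
    unfolding has_vector_derivative_def has_derivative_iff_norm by simp
  moreover have "filterlim (\<lambda>n. 1 / real (Suc n)) (at 0) sequentially"
    using LIMSEQ_Suc[OF lim_1_over_n] by (intro filterlim_atI) auto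
  ultimately have lim: "(\<lambda>n. norm ((?f (1 / real (Suc n)) - ?f 0) - (1 / real (Suc n) - 0) *\<^sub>R Q x) / norm (1 / real (Suc n) - 0)) \<longlonglongrightarrow> 0"
    by (rule filterlim_compose)
  have eq: "norm ((?f (1 / real (Suc n)) - ?f 0) - (1 / real (Suc n) - 0) *\<^sub>R Q x) / norm (1 / real (Suc n) - 0)
      = norm (real (Suc n) *\<^sub>R (?f (1 / real (Suc n)) - P x) - Q x)" for n
  proof -
    have "norm (real (Suc n) *\<^sub>R ((?f (1 / real (Suc n)) - P x) - (1 / real (Suc n)) *\<^sub>R Q x))
        = real (Suc n) * norm ((?f (1 / real (Suc n)) - P x) - (1 / real (Suc n)) *\<^sub>R Q x)" by simp
    moreover have "real (Suc n) *\<^sub>R ((?f (1 / real (Suc n)) - P x) - (1 / real (Suc n)) *\<^sub>R Q x)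
        = real (Suc n) *\<^sub>R (?f (1 / real (Suc n)) - P x) - Q x"
      by (simp add: scaleR_diff_right del: of_nat_Suc)
    ultimately show ?thesis by (simp add: mult.commute del: of_nat_Suc)
  qed
  show ?thesis
    using LIM_zero_cancel[OF tendsto_norm_zero_cancel[OF lim[unfolded eq]]] .
qed

lemma has_dir_deriv_lipschitz:
  assumes "has_dir_deriv b P Q" "convex K" and bound: "\<And>y. y \<in> K \<Longrightarrow> norm (Q y) \<le> C"
    and st: "x + s *\<^sub>R b \<in> K" "x + t *\<^sub>R b \<in> K"
  shows "norm (P (x + s *\<^sub>R b) - P (x + t *\<^sub>R b)) \<le> C * \<bar>s - t\<bar>"
proof -
  let ?U = "{r. x + r *\<^sub>R b \<in> K}"
  have "convex ?U"
  proof (rule convexI)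
    fix r r' u v :: real assume "r \<in> ?U" "r' \<in> ?U" and uv: "0 \<le> u" "0 \<le> v" "u + v = 1"
    then have "u *\<^sub>R (x + r *\<^sub>R b) + v *\<^sub>R (x + r' *\<^sub>R b) \<in> K"
      using \<open>convex K\<close> by (simp add: convexD)
    moreover have "u *\<^sub>R (x + r *\<^sub>R b) + v *\<^sub>R (x + r' *\<^sub>R b) = (u + v) *\<^sub>R x + (u * r + v * r') *\<^sub>R b"
      by (simp add: algebra_simps)
    ultimately show "u *\<^sub>R r + v *\<^sub>R r' \<in> ?U" using uv(3) by simp
  qed
  moreover have "((\<lambda>r. P (x + r *\<^sub>R b)) has_derivative (\<lambda>h. h *\<^sub>R Q (x + r *\<^sub>R b))) (at r within ?U)" for r
    using assms(1) unfolding has_dir_deriv_def has_vector_derivative_def by (blast intro: has_derivative_at_withinI)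
  moreover have "onorm (\<lambda>h. h *\<^sub>R Q (x + r *\<^sub>R b)) \<le> C" if "r \<in> ?U" for r
    using bound[of "x + r *\<^sub>R b"] that by (subst onorm_scaleR_left) (auto simp: onorm_id bounded_linear_ident)
  ultimately have "norm (P (x + s *\<^sub>R b) - P (x + t *\<^sub>R b)) \<le> C * norm (s - t)"
    by (rule differentiable_bound) (use st in auto)
  then show ?thesis by simp
qed

lemma set_integrable_bounded:
  fixes f :: "'a::euclidean_space \<Rightarrow> 'b::{banach, second_countable_topology}"
  assumes "A \<in> lmeasurable" "f \<in> borel_measurable borel" "\<And>x. x \<in> A \<Longrightarrow> norm (f x) \<le> B"
  shows "set_integrable lebesgue A f"
  unfolding set_integrable_def
proof (rule integrableI_bounded_set[of A _ _ B])
  have "f \<in> borel_measurable lebesgue" using assms(2) by (intro measurable_completion) simp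
  then show "(\<lambda>x. indicator A x *\<^sub>R f x) \<in> borel_measurable lebesgue"
    using assms(1) by (intro borel_measurable_scaleR borel_measurable_indicator) auto
qed (use assms in \<open>auto simp: fmeasurable_def\<close>)

lemma integral_difference_quotient_zero:
  fixes u :: "'a::euclidean_space \<Rightarrow> complex"
  assumes "integrable lborel u"
  shows "(LINT x|lborel. c *\<^sub>R (u (x + a) - u x)) = 0"
proof -
  have [measurable]: "u \<in> borel_measurable borel" using assms by auto
  have "integrable (distr lborel borel ((+) a)) u" using assms by (simp add: lborel_distr_plus)
  then have "integrable lborel (\<lambda>x. u (a + x))" by (subst (asm) integrable_distr_eq) auto
  moreover have "(LINT x|lborel. u (a + x)) = (LINT x|distr lborel borel ((+) a). u x)"
    by (rule integral_distr[symmetric]) auto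
  then have "(LINT x|lborel. u (a + x)) = (LINT x|lborel. u x)" by (simp only: lborel_distr_plus)
  ultimately show ?thesis using assms by (simp add: add.commute[of _ a])
qed

text \<open>
  Integration by parts without integrating over faces. For a test function \<open>\<phi>\<close>, the product
  \<open>u = v \<phi>\<close>, extended by zero, is Lipschitz along every line of direction \<open>b\<close>, because the
  line is covered by finitely many closed sets on each of which \<open>u\<close> is smooth or zero. The difference
  quotients of \<open>u\<close> have integral zero by translation invariance. They are uniformly bounded and
  converge, off the null set of element boundaries, to the piecewise derivative of \<open>v \<phi>\<close>, whose
  integral is therefore zero.
\<close>

lemma piecewise_has_weak_pderiv:
  fixes v :: "'a::euclidean_space \<Rightarrow> complex"
  assumes T: "finite T" "\<And>K. K \<in> T \<Longrightarrow> compact K" "\<And>K. K \<in> T \<Longrightarrow> convex K"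
    and disj: "\<And>K L. K \<in> T \<Longrightarrow> L \<in> T \<Longrightarrow> K \<noteq> L \<Longrightarrow> interior K \<inter> interior L = {}"
    and S: "open S" "S \<subseteq> \<Union>T"
    and v: "v \<in> borel_measurable borel"
    and PQ: "\<And>K. K \<in> T \<Longrightarrow> has_dir_deriv b (P K) (Q K)" and vP: "\<And>K x. K \<in> T \<Longrightarrow> x \<in> K \<Longrightarrow> x \<in> S \<Longrightarrow> v x = P K x"
    and b: "norm b = 1"
  shows "\<exists>g. g \<in> borel_measurable borel \<and> bounded (range g) \<and> has_weak_pderiv S b v g"
proof -
  define g where "g x = (\<Sum>K\<in>T. indicator (interior K) x *\<^sub>R Q K x)" for x
  have cont: "continuous_on UNIV (P K)" "continuous_on UNIV (Q K)" if "K \<in> T" for K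
    using PQ[OF that] unfolding has_dir_deriv_def by auto
  have g_meas [measurable]: "g \<in> borel_measurable borel"
    unfolding g_def using cont
    by (intro borel_measurable_sum borel_measurable_scaleR borel_measurable_indicator borel_measurable_continuous_onI) auto
  have bdd: "\<exists>B. \<forall>K\<in>T. \<forall>x\<in>K. norm (f K x) \<le> B"
    if "\<And>K. K \<in> T \<Longrightarrow> continuous_on UNIV (f K)" for f :: "'a set \<Rightarrow> 'a \<Rightarrow> complex"
  proof -
    have "bounded (f K ` K)" if "K \<in> T" for K
      using that \<open>\<And>K. K \<in> T \<Longrightarrow> continuous_on UNIV (f K)\<close> T(2)
      by (meson compact_continuous_image compact_imp_bounded continuous_on_subset top_greatest)
    then have "bounded (\<Union>K\<in>T. f K ` K)" using T(1) by auto
    then show ?thesis unfolding bounded_iff by auto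
  qed
  obtain BQ where BQ: "\<forall>K\<in>T. \<forall>x\<in>K. norm (Q K x) \<le> BQ" using bdd[of Q] cont by blast
  obtain BP where BP: "\<forall>K\<in>T. \<forall>x\<in>K. norm (P K x) \<le> BP" using bdd[of P] cont by blast
  have vB: "norm (v x) \<le> BP" if "x \<in> S" for x
  proof -
    obtain K where "K \<in> T" "x \<in> K" using \<open>x \<in> S\<close> S(2) by blast
    then show ?thesis using BP vP[of K x] \<open>x \<in> S\<close> by simp
  qed
  have g_bound: "norm (g x) \<le> (\<Sum>K\<in>T. \<bar>BQ\<bar>)" for x
    unfolding g_def
  proof (rule sum_norm_le)
    fix K assume "K \<in> T"
    then show "norm (indicator (interior K) x *\<^sub>R Q K x) \<le> \<bar>BQ\<bar>"
      using BQ interior_subset[of K] by (cases "x \<in> interior K") (auto intro: order_trans[OF _ abs_ge_self])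
  qed
  then have g_bdd: "bounded (range g)" unfolding bounded_iff by blast
  have loc_v: "locally_integrable S v"
    unfolding locally_integrable_def using v vB by (auto intro!: set_integrable_bounded lmeasurable_compact)
  have loc_g: "locally_integrable S g"
    unfolding locally_integrable_def using g_meas g_bound by (auto intro!: set_integrable_bounded lmeasurable_compact)
  have g_eq: "g x = Q K x" if "K \<in> T" "x \<in> interior K" for K x
  proof -
    have "indicator (interior L) x *\<^sub>R Q L x = (if L = K then Q K x else 0)" if "L \<in> T" for L
      using disj[OF \<open>K \<in> T\<close> that] \<open>x \<in> interior K\<close> by (auto split: split_indicator)
    then have "g x = (\<Sum>L\<in>T. if L = K then Q K x else 0)" unfolding g_def by (intro sum.cong) auto
    then show ?thesis using T(1) that(1) by simp
  qed
  have ibp: "(LINT x:S|lebesgue. v x * of_real (blinfun_apply (\<phi>' x) b)) = - (LINT x:S|lebesgue. g x * of_real (\<phi> x))"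
    if \<phi>: "test_function S \<phi> \<phi>'" for \<phi> \<phi>'
  proof -
    obtain K0 where K0: "compact K0" "K0 \<subseteq> S" "\<And>x. x \<notin> K0 \<Longrightarrow> \<phi> x = 0" "\<And>x. x \<notin> K0 \<Longrightarrow> \<phi>' x = 0"
      and cont_\<phi>: "continuous_on UNIV \<phi>" "\<And>b. continuous_on UNIV (\<lambda>x. blinfun_apply (\<phi>' x) b)"
      using test_function_support[OF \<phi>] by blast
    define u where "u x = v x * of_real (\<phi> x)" for x
    define w where "w x = g x * of_real (\<phi> x) + v x * of_real (blinfun_apply (\<phi>' x) b)" for x
    define D where "D n x = real (Suc n) *\<^sub>R (u (x + (1 / real (Suc n)) *\<^sub>R b) - u x)" for n x
    have \<phi>m: "\<phi> \<in> borel_measurable borel" "(\<lambda>x. blinfun_apply (\<phi>' x) b) \<in> borel_measurable borel"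
      using cont_\<phi> by (auto intro: borel_measurable_continuous_onI)
    have u_meas [measurable]: "u \<in> borel_measurable borel"
      unfolding u_def using v \<phi>m by measurable
    have w_meas [measurable]: "w \<in> borel_measurable borel"
      unfolding w_def using v g_meas \<phi>m by measurable
    define PP where "PP K x = P K x * of_real (\<phi> x)" for K x
    define QQ where "QQ K x = P K x * of_real (blinfun_apply (\<phi>' x) b) + Q K x * of_real (\<phi> x)" for K x
    have PPQQ: "has_dir_deriv b (PP K) (QQ K)" if "K \<in> T" for K
      unfolding PP_def QQ_def by (intro has_dir_deriv_mult PQ that test_function_has_dir_deriv[OF \<phi>])
    then have "continuous_on UNIV (QQ K)" if "K \<in> T" for K using that unfolding has_dir_deriv_def by blast
    then obtain C0 where C0: "\<forall>K\<in>T. \<forall>x\<in>K. norm (QQ K x) \<le> C0" using bdd[of QQ] by blast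
    define C where "C = \<bar>C0\<bar>"
    have C: "0 \<le> C" "\<And>K x. K \<in> T \<Longrightarrow> x \<in> K \<Longrightarrow> norm (QQ K x) \<le> C"
      using C0 by (auto simp: C_def intro: order_trans[OF _ abs_ge_self])
    have \<phi>0: "\<phi> x = 0" if "x \<notin> S" for x using K0(2,3) that by blast
    then have u0: "u x = 0" if "x \<notin> S" for x using that by (simp add: u_def)
    have uPP: "u x = PP K x" if "K \<in> T" "x \<in> K" for K x
      using vP[OF that] \<phi>0 by (cases "x \<in> S") (simp_all add: u_def PP_def)
    \<comment> \<open>The pieces of a line: its parts in the elements, and its part outside \<open>S\<close>, where \<open>u\<close> is zero.\<close>
    have lip: "norm (u (x + h *\<^sub>R b) - u x) \<le> C * h" if "0 \<le> h" for x h
    proof -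
      have "C-lipschitz_on {0..h} (\<lambda>t. u (x + t *\<^sub>R b))"
      proof (rule lipschitz_on_closed_Union[where I = "insert (- S) T" and U = "\<lambda>A. {t. x + t *\<^sub>R b \<in> A}"])
        fix A assume A: "A \<in> insert (- S) T"
        show "closed {t. x + t *\<^sub>R b \<in> A}"
        proof -
          have "closed A" using A S(1) T(2) compact_imp_closed by auto
          then have "closed ((\<lambda>t. x + t *\<^sub>R b) -` A)"
            by (intro continuous_closed_vimage) (auto intro!: continuous_intros)
          then show ?thesis by (simp add: vimage_def)
        qed
        show "C-lipschitz_on {t. x + t *\<^sub>R b \<in> A} (\<lambda>t. u (x + t *\<^sub>R b))"
        proof (cases "A \<in> T")
          case True
          show ?thesis
          proof (rule lipschitz_onI)
            fix s t assume "s \<in> {t. x + t *\<^sub>R b \<in> A}" "t \<in> {t. x + t *\<^sub>R b \<in> A}"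
            then show "dist (u (x + s *\<^sub>R b)) (u (x + t *\<^sub>R b)) \<le> C * dist s t"
              using has_dir_deriv_lipschitz[OF PPQQ[OF True] T(3)[OF True] C(2)[OF True], of x s t] uPP[OF True]
              by (simp add: dist_norm)
          qed (rule C(1))
        next
          case False
          then have "A = - S" using A by simp
          then show ?thesis using C(1) u0 by (intro lipschitz_onI) auto
        qed
      next
        show "{0..h} \<subseteq> (\<Union>A\<in>insert (- S) T. {t. x + t *\<^sub>R b \<in> A})" using S(2) by auto
      qed (use T(1) C(1) in auto)
      from lipschitz_onD[OF this, of h 0] show ?thesis using that by (simp add: dist_norm)
    qed
    obtain R where R: "\<And>x. x \<in> K0 \<Longrightarrow> norm x \<le> R" using compact_imp_bounded[OF K0(1)] unfolding bounded_iff by blast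
    have D_bound: "norm (D n x) \<le> indicator (cball 0 (R + 1)) x *\<^sub>R C" for n x
    proof (cases "norm x \<le> R + 1")
      case True
      have "norm (D n x) = real (Suc n) * norm (u (x + (1 / real (Suc n)) *\<^sub>R b) - u x)"
        unfolding D_def by simp
      also have "\<dots> \<le> real (Suc n) * (C * (1 / real (Suc n)))" by (intro mult_left_mono lip) auto
      also have "\<dots> = C" by simp
      finally show ?thesis using True by simp
    next
      case False
      have "norm x - norm ((1 / real (Suc n)) *\<^sub>R b) \<le> norm (x + (1 / real (Suc n)) *\<^sub>R b)"
        by (rule norm_diff_ineq)
      moreover have "norm ((1 / real (Suc n)) *\<^sub>R b) \<le> 1" using b by simp
      ultimately have "R < norm (x + (1 / real (Suc n)) *\<^sub>R b)" "R < norm x" using False by linarith+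
      then have "x + (1 / real (Suc n)) *\<^sub>R b \<notin> K0" "x \<notin> K0"
        using R[of x] R[of "x + (1 / real (Suc n)) *\<^sub>R b"] by (meson not_less)+
      then have "D n x = 0" using K0(3) by (simp add: D_def u_def)
      then show ?thesis using C(1) by simp
    qed
    have "AE x in lebesgue. x \<notin> (\<Union>K\<in>T. frontier K)"
    proof (rule AE_not_in)
      have "negligible (\<Union>K\<in>T. frontier K)"
        using T by (intro negligible_Union) (auto simp: negligible_convex_frontier)
      then show "(\<Union>K\<in>T. frontier K) \<in> null_sets lebesgue" by (simp add: negligible_iff_null_sets)
    qed
    then have AE_front: "AE x in lborel. x \<notin> (\<Union>K\<in>T. frontier K)" by (simp only: AE_completion_iff)
    have step: "(\<lambda>n. x + (1 / real (Suc n)) *\<^sub>R b) \<longlonglongrightarrow> x" for x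
    proof -
      have "(\<lambda>n. x + (1 / real (Suc n)) *\<^sub>R b) \<longlonglongrightarrow> x + 0 *\<^sub>R b"
        by (intro tendsto_intros LIMSEQ_Suc[OF lim_1_over_n])
      then show ?thesis by simp
    qed
    have lim: "(\<lambda>n. D n x) \<longlonglongrightarrow> w x" if x: "x \<notin> (\<Union>K\<in>T. frontier K)" for x
    proof (cases "x \<in> K0")
      case False
      have "\<forall>\<^sub>F n in sequentially. x + (1 / real (Suc n)) *\<^sub>R b \<in> - K0"
        using False K0(1) by (intro topological_tendstoD[OF step]) (auto simp: compact_imp_closed open_Compl)
      then have "\<forall>\<^sub>F n in sequentially. D n x = 0"
        by eventually_elim (use False K0(3) in \<open>simp add: D_def u_def\<close>)
      moreover have "w x = 0" using False K0 by (simp add: w_def)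
      ultimately show ?thesis by (simp add: tendsto_eventually)
    next
      case True
      then obtain K where K: "K \<in> T" "x \<in> K" using K0(2) S(2) by blast
      then have xi: "x \<in> interior K"
        using x T(2)[of K] by (auto simp: frontier_def compact_imp_closed closure_closed)
      have "\<forall>\<^sub>F n in sequentially. x + (1 / real (Suc n)) *\<^sub>R b \<in> interior K"
        using xi by (intro topological_tendstoD[OF step]) auto
      then have "\<forall>\<^sub>F n in sequentially. real (Suc n) *\<^sub>R (PP K (x + (1 / real (Suc n)) *\<^sub>R b) - PP K x) = D n x"
        by eventually_elim (use interior_subset[of K] uPP[OF K(1)] K(2) in \<open>auto simp: D_def\<close>)
      then have "(\<lambda>n. D n x) \<longlonglongrightarrow> QQ K x"
        using has_dir_deriv_difference_quotient[OF PPQQ[OF K(1)], of x] by (rule Lim_transform_eventually[rotated])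
      moreover have "QQ K x = w x" using g_eq[OF K(1) xi] vP[OF K] True K0(2) by (simp add: subset_iff QQ_def w_def)
      ultimately show ?thesis by simp
    qed
    have "(\<lambda>n. LINT x|lborel. D n x) \<longlonglongrightarrow> (LINT x|lborel. w x)"
    proof (rule integral_dominated_convergence[where w = "\<lambda>x. indicator (cball 0 (R + 1)) x *\<^sub>R C"])
      show "integrable lborel (\<lambda>x. indicator (cball (0::'a) (R + 1)) x *\<^sub>R C)"
        using emeasure_lborel_cball_finite[of 0 "R + 1"] by (intro integrable_scaleR_left integrable_real_indicator) auto
      show "AE x in lborel. (\<lambda>n. D n x) \<longlonglongrightarrow> w x" using AE_front by eventually_elim (rule lim)
      show "D n \<in> borel_measurable lborel" for n unfolding D_def by measurable
    qed (use D_bound in auto)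
    moreover have "(LINT x|lborel. D n x) = 0" for n
    proof -
      have "set_integrable lebesgue S u"
        unfolding u_def by (rule set_integrable_test_function(1)[OF loc_v \<phi>])
      moreover have "indicator S x *\<^sub>R u x = u x" for x using u0[of x] by (cases "x \<in> S") auto
      ultimately have "integrable lborel u" by (simp add: set_integrable_def integrable_completion)
      then show ?thesis unfolding D_def by (rule integral_difference_quotient_zero)
    qed
    ultimately have "(LINT x|lborel. w x) = 0" by (simp add: LIMSEQ_const_iff)
    moreover have "(LINT x|lborel. w x) = (LINT x:S|lebesgue. w x)"
    proof -
      have "w x = 0" if "x \<notin> S" for x
      proof -
        have "x \<notin> K0" using that K0(2) by blast
        then show ?thesis by (simp add: w_def K0(3,4))
      qed
      then have "indicator S x *\<^sub>R w x = w x" for x by (cases "x \<in> S") auto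
      then show ?thesis unfolding set_lebesgue_integral_def by (simp add: integral_completion)
    qed
    moreover have "(LINT x:S|lebesgue. w x) = (LINT x:S|lebesgue. g x * of_real (\<phi> x)) + (LINT x:S|lebesgue. v x * of_real (blinfun_apply (\<phi>' x) b))"
      unfolding w_def by (intro set_integral_add set_integrable_test_function(1)[OF loc_g \<phi>] set_integrable_test_function(2)[OF loc_v \<phi>])
    ultimately show ?thesis by (simp add: add_eq_0_iff)
  qed
  show ?thesis using g_meas g_bdd loc_v loc_g ibp unfolding has_weak_pderiv_def by blast
qed

section \<open>Finite element functions on a subdomain\<close>

lemma restrict_zero_lincomb:
  "restrict_zero A (\<lambda>x. u x + c * v x) = (\<lambda>x. restrict_zero A u x + c * restrict_zero A v x)"
  by (auto simp: restrict_zero_def)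

lemma poly_total_degree_lincomb:
  assumes "poly_total_degree_le p P" "poly_total_degree_le p Q"
  shows "poly_total_degree_le p (\<lambda>x. P x + c * Q x)"
proof -
  let ?A = "{\<alpha> \<in> Basis \<rightarrow>\<^sub>E {..p}. (\<Sum>b\<in>Basis. \<alpha> b) \<le> p} :: ('a \<Rightarrow> nat) set"
  let ?m = "\<lambda>\<alpha> x. complex_of_real (\<Prod>b\<in>Basis. (x \<bullet> b) ^ \<alpha> b)"
  obtain d where d: "\<forall>x. P x = (\<Sum>\<alpha>\<in>?A. d \<alpha> * ?m \<alpha> x)"
    using assms(1) unfolding poly_total_degree_le_def by (elim exE)
  obtain e where e: "\<forall>x. Q x = (\<Sum>\<alpha>\<in>?A. e \<alpha> * ?m \<alpha> x)"
    using assms(2) unfolding poly_total_degree_le_def by (elim exE)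
  have "P x + c * Q x = (\<Sum>\<alpha>\<in>?A. (d \<alpha> + c * e \<alpha>) * ?m \<alpha> x)" for x
    using d e by (simp only: distrib_right mult.assoc sum.distrib sum_distrib_left)
  then show ?thesis unfolding poly_total_degree_le_def by (intro exI[of _ "\<lambda>\<alpha>. d \<alpha> + c * e \<alpha>"] allI)
qed

lemma FE_space_lincomb:
  assumes u: "u \<in> FE_space \<Omega> T p" and v: "v \<in> FE_space \<Omega> T p"
  shows "(\<lambda>x. u x + c * v x) \<in> FE_space \<Omega> T p"
proof -
  have "\<exists>P. poly_total_degree_le p P \<and> (\<forall>x\<in>K. u x + c * v x = P x)" if "K \<in> T" for K
  proof -
    obtain P Q where "poly_total_degree_le p P" "\<forall>x\<in>K. u x = P x" "poly_total_degree_le p Q" "\<forall>x\<in>K. v x = Q x"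
      using u v \<open>K \<in> T\<close> unfolding FE_space_def by blast
    then show ?thesis by (intro exI[of _ "\<lambda>x. P x + c * Q x"]) (simp add: poly_total_degree_lincomb)
  qed
  moreover have "continuous_on (closure \<Omega>) (\<lambda>x. u x + c * v x)"
    using u v unfolding FE_space_def by (intro continuous_intros) simp_all
  moreover have "u x + c * v x = 0" if "x \<notin> closure \<Omega>" for x
    using u v that unfolding FE_space_def by simp
  ultimately show ?thesis unfolding FE_space_def by simp
qed

lemma FE_local_lincomb:
  assumes "u \<in> FE_local \<Omega> T p S" "v \<in> FE_local \<Omega> T p S"
  shows "(\<lambda>x. u x + c * v x) \<in> FE_local \<Omega> T p S"
proof -
  obtain u0 v0 where "u0 \<in> FE_space \<Omega> T p" "v0 \<in> FE_space \<Omega> T p"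
    and uv: "u = restrict_zero (closure S) u0" "v = restrict_zero (closure S) v0"
    using assms unfolding FE_local_def by blast
  note FE_space_lincomb[OF this(1,2), of c]
  moreover have "(\<lambda>x. u x + c * v x) = restrict_zero (closure S) (\<lambda>x. u0 x + c * v0 x)"
    unfolding uv by (rule restrict_zero_lincomb[symmetric])
  ultimately show ?thesis unfolding FE_local_def by blast
qed

lemma conforming_simplicial_mesh_elements:
  fixes \<Omega> :: "'a::euclidean_space set"
  assumes "conforming_simplicial_mesh T \<Omega>"
  shows "finite T" "\<And>K. K \<in> T \<Longrightarrow> compact K" "\<And>K. K \<in> T \<Longrightarrow> convex K" "\<Union>T = closure \<Omega>"
    "\<And>K L. K \<in> T \<Longrightarrow> L \<in> T \<Longrightarrow> K \<noteq> L \<Longrightarrow> interior K \<inter> interior L = {}"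
proof -
  have T: "triangulation T" "\<forall>K\<in>T. int DIM('a) simplex K" "\<Union>T = closure \<Omega>"
    using assms unfolding conforming_simplicial_mesh_def by simp_all
  show "finite T" using T(1) unfolding triangulation_def by (elim conjE)
  show "\<Union>T = closure \<Omega>" by (rule T(3))
  have cc: "compact K \<and> convex K" if K: "K \<in> T" for K
  proof -
    have "int DIM('a) simplex K" by (rule bspec[OF T(2) K])
    then obtain C where "finite C" "K = convex hull C" unfolding simplex by (elim exE conjE)
    then show ?thesis by (simp add: finite_imp_compact_convex_hull convex_convex_hull)
  qed
  show "\<And>K. K \<in> T \<Longrightarrow> compact K" "\<And>K. K \<in> T \<Longrightarrow> convex K" using cc by simp_all
  fix K L assume KL: "K \<in> T" "L \<in> T" "K \<noteq> L"
  have face: "(A \<inter> B) face_of A" if "A \<in> T" "B \<in> T" for A B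
    using T(1) that unfolding triangulation_def by simp
  show "interior K \<inter> interior L = {}"
  proof (rule ccontr)
    assume "interior K \<inter> interior L \<noteq> {}"
    then obtain x where x: "x \<in> interior K" "x \<in> interior L" by blast
    then have xKL: "x \<in> K \<inter> L" using interior_subset by blast
    have "K \<inter> L = K"
      using face_of_disjoint_interior[OF face[OF KL(1,2)]] x(1) xKL by blast
    moreover have "L \<inter> K = L"
      using face_of_disjoint_interior[OF face[OF KL(2,1)]] x(2) xKL by blast
    ultimately show False using KL(3) by blast
  qed
qed

lemma bounded_range_mult_add:
  fixes f g :: "'a::euclidean_space \<Rightarrow> complex"
  assumes "bounded (range f)" "bounded (range g)"
  shows "bounded (range (\<lambda>x. f x * g x))" "bounded (range (\<lambda>x. f x + g x))"
proof -
  obtain B C where B: "\<And>x. norm (f x) \<le> B" and C: "\<And>x. norm (g x) \<le> C"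
    using assms unfolding bounded_iff by auto
  have "norm (f x * g x) \<le> B * C" for x
    unfolding norm_mult using B C by (intro mult_mono) (auto intro: order_trans[OF norm_ge_zero])
  then show "bounded (range (\<lambda>x. f x * g x))" unfolding bounded_iff by blast
  have "norm (f x + g x) \<le> B + C" for x by (intro norm_triangle_mono B C)
  then show "bounded (range (\<lambda>x. f x + g x))" unfolding bounded_iff by blast
qed

text \<open>
  An algebra of functions all of which are integrable over a bounded domain and over its boundary;
  finite element functions and their weak derivatives belong to it.
\<close>

definition bdd_borel :: "('a::euclidean_space \<Rightarrow> complex) \<Rightarrow> bool" where
  "bdd_borel f \<longleftrightarrow> f \<in> borel_measurable borel \<and> bounded (range f)"

lemma bdd_borel_const: "bdd_borel (\<lambda>x. c)"
  unfolding bdd_borel_def bounded_iff by auto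

lemma bdd_borel_add: "bdd_borel f \<Longrightarrow> bdd_borel g \<Longrightarrow> bdd_borel (\<lambda>x. f x + g x)"
  unfolding bdd_borel_def by (simp add: bounded_range_mult_add borel_measurable_add)

lemma bdd_borel_mult: "bdd_borel f \<Longrightarrow> bdd_borel g \<Longrightarrow> bdd_borel (\<lambda>x. f x * g x)"
  unfolding bdd_borel_def by (simp add: bounded_range_mult_add borel_measurable_times)

lemma bdd_borel_cnj:
  assumes "bdd_borel f" shows "bdd_borel (\<lambda>x. cnj (f x))"
proof -
  have "(\<lambda>x. cnj (f x)) \<in> borel_measurable borel"
    using assms unfolding bdd_borel_def
    by (intro measurable_compose[OF _ borel_measurable_continuous_onI[OF continuous_on_cnj[OF continuous_on_id]]]) simp
  then show ?thesis using assms by (simp add: bdd_borel_def bounded_iff)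
qed

lemma bdd_borel_sum: "(\<And>i. i \<in> I \<Longrightarrow> bdd_borel (f i)) \<Longrightarrow> bdd_borel (\<lambda>x. \<Sum>i\<in>I. f i x)"
  by (induction I rule: infinite_finite_induct) (auto intro!: bdd_borel_const bdd_borel_add)

lemmas bdd_borel_intros = bdd_borel_const bdd_borel_add bdd_borel_mult bdd_borel_cnj bdd_borel_sum

locale fe_subdomain =
  fixes \<Omega> S :: "'a::euclidean_space set" and T :: "'a set set" and p :: nat
  assumes dom: "lipschitz_polyhedral_domain \<Omega>" and mesh: "conforming_simplicial_mesh T \<Omega>"
    and sub: "lipschitz_polyhedral_domain S" "S \<subseteq> \<Omega>"
begin

abbreviation "V \<equiv> FE_local \<Omega> T p S"
abbreviation "\<Gamma> \<equiv> interface \<Omega> S"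

lemma open_S: "open S" and bounded_S: "bounded S" and compact_closure_S: "compact (closure S)"
  using sub(1) unfolding lipschitz_polyhedral_domain_def by auto

lemma lmeasurable_S: "S \<in> lmeasurable"
  using open_S bounded_S by (rule lmeasurable_open[rotated])

lemma closure_S_sub: "closure S \<subseteq> closure \<Omega>"
  using sub(2) by (rule closure_mono)

lemma frontier_S_sub: "frontier S \<subseteq> closure S"
  by (simp add: frontier_def Diff_subset)

lemma interface_sub: "\<Gamma> \<subseteq> frontier S"
  by (auto simp: interface_def)

lemma interface_borel: "\<Gamma> \<in> sets borel"
  unfolding interface_def by simp

lemma surface_finite: "A \<subseteq> frontier S \<Longrightarrow> emeasure surface_measure A < \<infinity>"
  using surface_measure_frontier_finite[OF sub(1)] emeasure_mono[of A "frontier S" surface_measure]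
  by (metis frontier_closed borel_closed infinity_ennreal_def order_le_less_trans sets_surface_measure)

lemma FE_local_continuous:
  assumes "v \<in> V" shows "continuous_on (closure S) v"
proof -
  obtain v0 where "v0 \<in> FE_space \<Omega> T p" and v: "v = restrict_zero (closure S) v0"
    using assms unfolding FE_local_def by blast
  then have "continuous_on (closure S) v0"
    using closure_S_sub unfolding FE_space_def by (auto intro: continuous_on_subset)
  then show ?thesis unfolding v by (rule continuous_on_eq) (simp add: restrict_zero_def)
qed

lemma FE_local_bdd_borel:
  assumes "v \<in> V" shows "bdd_borel v"
proof -
  have zero: "v x = 0" if "x \<notin> closure S" for x
    using assms that unfolding FE_local_def restrict_zero_def by auto
  have "(\<lambda>x. if x \<in> closure S then v x else 0) \<in> borel_measurable borel"
    using FE_local_continuous[OF assms] by (intro borel_measurable_continuous_on_if) auto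
  moreover have "(\<lambda>x. if x \<in> closure S then v x else 0) = v" using zero by auto
  moreover have "bounded (v ` closure S)"
    by (intro compact_imp_bounded compact_continuous_image FE_local_continuous assms compact_closure_S)
  then obtain B where B: "\<And>x. x \<in> closure S \<Longrightarrow> norm (v x) \<le> B" unfolding bounded_iff by auto
  have "norm (v x) \<le> \<bar>B\<bar>" for x using B[of x] zero[of x] by (cases "x \<in> closure S") auto
  then have "bounded (range v)" unfolding bounded_iff by blast
  ultimately show ?thesis unfolding bdd_borel_def by simp
qed

lemma set_integrable_domain: "bdd_borel f \<Longrightarrow> set_integrable lebesgue S f"
  unfolding bdd_borel_def bounded_iff by (auto intro!: set_integrable_bounded[OF lmeasurable_S])

lemma set_integrable_surface:
  assumes "bdd_borel f" "A \<in> sets borel" "A \<subseteq> frontier S"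
  shows "set_integrable surface_measure A f"
  unfolding set_integrable_def
proof -
  obtain B where B: "\<And>x. norm (f x) \<le> B" using assms(1) unfolding bdd_borel_def bounded_iff by auto
  have "f \<in> borel_measurable surface_measure" using assms(1) unfolding bdd_borel_def
    by (simp cong: measurable_cong_sets)
  then show "integrable surface_measure (\<lambda>x. indicator A x *\<^sub>R f x)"
    using assms B surface_finite[OF assms(3)]
    by (intro integrableI_bounded_set[of A _ _ B] borel_measurable_scaleR borel_measurable_indicator) auto
qed

lemma FE_local_weak_pderiv:
  assumes "v \<in> V" "b \<in> Basis"
  shows "\<exists>g. bdd_borel g \<and> has_weak_pderiv S b v g"
proof -
  obtain v0 where v0: "v0 \<in> FE_space \<Omega> T p" and v: "v = restrict_zero (closure S) v0"
    using assms unfolding FE_local_def by blast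
  have "\<exists>P. poly_total_degree_le p P \<and> (\<forall>x\<in>K. v0 x = P x)" if "K \<in> T" for K
    using v0 that unfolding FE_space_def by blast
  then obtain P where P: "\<And>K. K \<in> T \<Longrightarrow> poly_total_degree_le p (P K)" "\<And>K x. K \<in> T \<Longrightarrow> x \<in> K \<Longrightarrow> v0 x = P K x"
    by metis
  have "\<forall>K\<in>T. \<exists>Q. has_dir_deriv b (P K) Q"
    using P(1) poly_total_degree_has_dir_deriv by blast
  from bchoice[OF this] obtain Q where Q: "\<And>K. K \<in> T \<Longrightarrow> has_dir_deriv b (P K) (Q K)" by blast
  note m = conforming_simplicial_mesh_elements[OF mesh]
  have sT: "S \<subseteq> \<Union>T" unfolding m(4) using closure_S_sub closure_subset by blast
  have vm: "v \<in> borel_measurable borel" using FE_local_bdd_borel[OF assms(1)] unfolding bdd_borel_def by simp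
  have vP: "v x = P K x" if "K \<in> T" "x \<in> K" "x \<in> S" for K x
    using P(2)[OF that(1,2)] that(3) closure_subset[of S] by (auto simp: v restrict_zero_def)
  have nb: "norm b = 1" using assms(2) by simp
  have "\<exists>g. g \<in> borel_measurable borel \<and> bounded (range g) \<and> has_weak_pderiv S b v g"
    by (rule piecewise_has_weak_pderiv[where T = T and P = P and Q = Q]; fact m open_S sT vm Q vP nb)
  then show ?thesis unfolding bdd_borel_def by blast
qed

lemma FE_local_weak_gradient:
  assumes "v \<in> V"
  obtains G where "\<And>b. b \<in> Basis \<Longrightarrow> bdd_borel (G b)" "\<And>b. b \<in> Basis \<Longrightarrow> has_weak_pderiv S b v (G b)"
  using FE_local_weak_pderiv[OF assms] by metis

definition form_density :: "real \<Rightarrow> ('a \<Rightarrow> 'a \<Rightarrow> complex) \<Rightarrow> ('a \<Rightarrow> complex) \<Rightarrow> ('a \<Rightarrow> 'a \<Rightarrow> complex) \<Rightarrow> ('a \<Rightarrow> complex) \<Rightarrow> 'a \<Rightarrow> complex" where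
  "form_density k G u H v x = (\<Sum>b\<in>Basis. G b x * cnj (H b x)) - (of_real k)\<^sup>2 * u x * cnj (v x)"

lemma bdd_borel_form_density:
  assumes "\<And>b. b \<in> Basis \<Longrightarrow> bdd_borel (G b)" "\<And>b. b \<in> Basis \<Longrightarrow> bdd_borel (H b)" "bdd_borel u" "bdd_borel v"
  shows "bdd_borel (form_density k G u H v)"
proof -
  have "bdd_borel (\<lambda>x. (\<Sum>b\<in>Basis. G b x * cnj (H b x)) + (- (of_real k)\<^sup>2) * u x * cnj (v x))"
    using assms by (intro bdd_borel_intros)
  then show ?thesis unfolding form_density_def by simp
qed

text \<open>
  The chosen weak derivatives may be replaced by explicit bounded Borel ones, so that the volume term
  becomes the integral of a bounded function and can be split.
\<close>

lemma helmholtz_form_weak_gradient: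
  assumes "u \<in> V" "v \<in> V"
    and G: "\<And>b. b \<in> Basis \<Longrightarrow> bdd_borel (G b)" "\<And>b. b \<in> Basis \<Longrightarrow> has_weak_pderiv S b u (G b)"
    and H: "\<And>b. b \<in> Basis \<Longrightarrow> bdd_borel (H b)" "\<And>b. b \<in> Basis \<Longrightarrow> has_weak_pderiv S b v (H b)"
  shows "helmholtz_form S k u v = (LINT x:S|lebesgue. form_density k G u H v x)
     - \<i> * of_real k * (LINT x:frontier S|surface_measure. u x * cnj (v x))"
proof -
  let ?W = "\<lambda>x. (\<Sum>b\<in>Basis. weak_pderiv S b u x * cnj (weak_pderiv S b v x)) - (of_real k)\<^sup>2 * u x * cnj (v x)"
  have "AE x in lebesgue. \<forall>b\<in>Basis. x \<in> S \<longrightarrow> weak_pderiv S b u x = G b x"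
    by (intro AE_ball_countable' weak_pderiv_AE open_S G countable_finite) auto
  moreover have "AE x in lebesgue. \<forall>b\<in>Basis. x \<in> S \<longrightarrow> weak_pderiv S b v x = H b x"
    by (intro AE_ball_countable' weak_pderiv_AE open_S H countable_finite) auto
  ultimately have AE: "AE x in lebesgue. indicator S x *\<^sub>R form_density k G u H v x = indicator S x *\<^sub>R ?W x"
    by eventually_elim (auto simp: form_density_def split: split_indicator)
  have meas: "(\<lambda>x. indicator S x *\<^sub>R form_density k G u H v x) \<in> borel_measurable lebesgue"
  proof -
    have "bdd_borel (form_density k G u H v)"
      by (intro bdd_borel_form_density G H FE_local_bdd_borel assms)
    from set_integrable_domain[OF this] show ?thesis
      unfolding set_integrable_def by (rule borel_measurable_integrable)
  qed
  have "(LINT x:S|lebesgue. form_density k G u H v x) = (LINT x:S|lebesgue. ?W x)"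
    unfolding set_lebesgue_integral_def by (rule integral_cong_AE[OF meas borel_measurable_AE[OF meas AE] AE])
  then show ?thesis unfolding helmholtz_form_def by simp
qed

lemma helmholtz_form_antilinear:
  assumes "w \<in> V" "u \<in> V" "v \<in> V"
  shows "helmholtz_form S k w (\<lambda>x. u x + c * v x) = helmholtz_form S k w u + cnj c * helmholtz_form S k w v"
proof -
  obtain W where W: "\<And>b. b \<in> Basis \<Longrightarrow> bdd_borel (W b)" "\<And>b. b \<in> Basis \<Longrightarrow> has_weak_pderiv S b w (W b)"
    using FE_local_weak_gradient[OF assms(1)] by metis
  obtain G where G: "\<And>b. b \<in> Basis \<Longrightarrow> bdd_borel (G b)" "\<And>b. b \<in> Basis \<Longrightarrow> has_weak_pderiv S b u (G b)"
    using FE_local_weak_gradient[OF assms(2)] by metis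
  obtain H where H: "\<And>b. b \<in> Basis \<Longrightarrow> bdd_borel (H b)" "\<And>b. b \<in> Basis \<Longrightarrow> has_weak_pderiv S b v (H b)"
    using FE_local_weak_gradient[OF assms(3)] by metis
  define GH where "GH b x = G b x + c * H b x" for b x
  have GH: "bdd_borel (GH b)" "has_weak_pderiv S b (\<lambda>x. u x + c * v x) (GH b)" if "b \<in> Basis" for b
    unfolding GH_def using G H that by (auto intro!: bdd_borel_intros has_weak_pderiv_lincomb)
  note bb = FE_local_bdd_borel[OF assms(1)] FE_local_bdd_borel[OF assms(2)] FE_local_bdd_borel[OF assms(3)]
  have "form_density k W w GH (\<lambda>x. u x + c * v x) x = form_density k W w G u x + cnj c * form_density k W w H v x" for x
    unfolding form_density_def GH_def by (simp add: algebra_simps sum.distrib sum_distrib_left)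
  moreover have "bdd_borel (form_density k W w G u)" by (rule bdd_borel_form_density) (simp_all add: W G bb)
  moreover have "bdd_borel (form_density k W w H v)" by (rule bdd_borel_form_density) (simp_all add: W H bb)
  ultimately have vol: "(LINT x:S|lebesgue. form_density k W w GH (\<lambda>x. u x + c * v x) x)
      = (LINT x:S|lebesgue. form_density k W w G u x) + cnj c * (LINT x:S|lebesgue. form_density k W w H v x)"
    by (simp add: set_integral_add set_integrable_domain)
  have "(LINT x:frontier S|surface_measure. w x * cnj (u x + c * v x))
      = (LINT x:frontier S|surface_measure. w x * cnj (u x) + cnj c * (w x * cnj (v x)))"
    by (simp add: algebra_simps)
  also have "\<dots> = (LINT x:frontier S|surface_measure. w x * cnj (u x)) + cnj c * (LINT x:frontier S|surface_measure. w x * cnj (v x))"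
    using set_integrable_surface[OF bdd_borel_mult[OF bb(1) bdd_borel_cnj[OF bb(2)]], of "frontier S"]
      set_integrable_surface[OF bdd_borel_mult[OF bb(1) bdd_borel_cnj[OF bb(3)]], of "frontier S"]
    by (simp add: set_integral_add frontier_closed)
  finally have bnd: "(LINT x:frontier S|surface_measure. w x * cnj (u x + c * v x))
      = (LINT x:frontier S|surface_measure. w x * cnj (u x)) + cnj c * (LINT x:frontier S|surface_measure. w x * cnj (v x))" .
  have alg: "(a + c' * b) - s * (d + c' * e) = (a - s * d) + c' * (b - s * e)" for a b c' d e s :: complex
    by (simp add: algebra_simps)
  have "helmholtz_form S k w (\<lambda>x. u x + c * v x) = (LINT x:S|lebesgue. form_density k W w GH (\<lambda>x. u x + c * v x) x)
     - \<i> * of_real k * (LINT x:frontier S|surface_measure. w x * cnj (u x + c * v x))"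
    by (intro helmholtz_form_weak_gradient assms FE_local_lincomb W GH)
  moreover have "helmholtz_form S k w u = (LINT x:S|lebesgue. form_density k W w G u x)
     - \<i> * of_real k * (LINT x:frontier S|surface_measure. w x * cnj (u x))"
    by (intro helmholtz_form_weak_gradient assms W G)
  moreover have "helmholtz_form S k w v = (LINT x:S|lebesgue. form_density k W w H v x)
     - \<i> * of_real k * (LINT x:frontier S|surface_measure. w x * cnj (v x))"
    by (intro helmholtz_form_weak_gradient assms W H)
  ultimately show ?thesis unfolding vol bnd by (simp only: alg)
qed

lemma square_integrable_domain: "bdd_borel f \<Longrightarrow> square_integrable lebesgue S f"
  and square_integrable_surface: "bdd_borel f \<Longrightarrow> square_integrable surface_measure (frontier S) f"
proof -
  assume f: "bdd_borel f"
  have sq: "Re (indicator A x *\<^sub>R (f x * cnj (f x))) = indicator A x *\<^sub>R (norm (f x))\<^sup>2" for A x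
    using complex_norm_square[of "f x"] by (simp del: of_real_power flip: complex_norm_square)
  have "bdd_borel (\<lambda>x. f x * cnj (f x))" by (intro bdd_borel_intros f)
  from set_integrable_domain[OF this] set_integrable_surface[OF this, of "frontier S"]
  have 1: "set_integrable lebesgue S (\<lambda>x. (norm (f x))\<^sup>2)"
    and 2: "set_integrable surface_measure (frontier S) (\<lambda>x. (norm (f x))\<^sup>2)"
    unfolding set_integrable_def sq[symmetric] by (simp_all add: frontier_closed del: scaleR_complex.sel)
  show "square_integrable lebesgue S f" "square_integrable surface_measure (frontier S) f"
    using 1 2 set_integrable_domain[OF f] set_integrable_surface[OF f, of "frontier S"]
    unfolding square_integrable_def set_integrable_def set_borel_measurable_def
    by (auto simp: frontier_closed)
qed

lemma FE_local_H1: "v \<in> V \<Longrightarrow> v \<in> H1 S"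
  unfolding H1_def using FE_local_weak_pderiv square_integrable_domain FE_local_bdd_borel by blast

lemma H1_norm_sq_zero: "H1_norm_sq S (\<lambda>x. 0) = 0"
proof -
  have "has_weak_pderiv S b (\<lambda>x. 0) (\<lambda>x. 0)" for b
    unfolding has_weak_pderiv_def locally_integrable_def by (simp add: set_lebesgue_integral_def set_integrable_def)
  then have "AE x in lebesgue. \<forall>b\<in>Basis. x \<in> S \<longrightarrow> weak_pderiv S b (\<lambda>x. 0) x = 0"
    by (intro AE_ball_countable' weak_pderiv_AE open_S countable_finite) auto
  then have "AE x in lebesgue. indicator S x *\<^sub>R ((norm (0::complex))\<^sup>2 + (\<Sum>b\<in>Basis. (norm (weak_pderiv S b (\<lambda>x. 0) x))\<^sup>2)) = 0"
    by eventually_elim (auto split: split_indicator)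
  then show ?thesis unfolding H1_norm_sq_def set_lebesgue_integral_def by (rule integral_eq_zero_AE)
qed

text \<open>
  A continuous function in \<open>H\<^sup>1\<close> is approximated by the constant sequence.
\<close>

lemma FE_local_has_trace:
  assumes "v \<in> V" shows "has_trace S v v"
  unfolding has_trace_def
proof (intro conjI exI[of _ "\<lambda>_. v"] allI)
  show "square_integrable surface_measure (frontier S) v"
    by (intro square_integrable_surface FE_local_bdd_borel assms)
qed (use assms FE_local_H1 FE_local_continuous H1_norm_sq_zero in \<open>auto simp: set_lebesgue_integral_def\<close>)

text \<open>
  This is where harmonicity enters: a finite element function that is zero on the interface is an
  admissible test function.
\<close>

lemma discrete_harmonic_vanishes:
  assumes w: "w \<in> discrete_harmonic \<Omega> T p k S" and v: "v \<in> V" and zero: "\<And>x. x \<in> \<Gamma> \<Longrightarrow> v x = 0"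
  shows "helmholtz_form S k w v = 0"
proof -
  have "v \<in> H1_zero_on S \<Gamma>"
    unfolding H1_zero_on_def using FE_local_H1[OF v] FE_local_has_trace[OF v] zero by (auto intro!: exI[of _ v])
  then show ?thesis using w v unfolding discrete_harmonic_def by blast
qed

definition interface_inner :: "('a \<Rightarrow> complex) \<Rightarrow> ('a \<Rightarrow> complex) \<Rightarrow> complex" where
  "interface_inner u v = (LINT x:\<Gamma>|surface_measure. u x * cnj (v x))"

lemma interface_integrable:
  assumes "u \<in> V" "v \<in> V" shows "set_integrable surface_measure \<Gamma> (\<lambda>x. u x * cnj (v x))"
  using assms by (intro set_integrable_surface bdd_borel_intros FE_local_bdd_borel interface_borel interface_sub)

lemma interface_inner_add_left:
  assumes "u \<in> V" "v \<in> V" "z \<in> V"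
  shows "interface_inner (\<lambda>x. u x + c * v x) z = interface_inner u z + c * interface_inner v z"
proof -
  have "interface_inner (\<lambda>x. u x + c * v x) z = (LINT x:\<Gamma>|surface_measure. u x * cnj (z x) + c * (v x * cnj (z x)))"
    unfolding interface_inner_def by (simp add: algebra_simps)
  then show ?thesis
    unfolding interface_inner_def using interface_integrable assms by (simp add: set_integral_add)
qed

lemma interface_inner_sym: "interface_inner v u = cnj (interface_inner u v)"
  unfolding interface_inner_def set_lebesgue_integral_def
  unfolding Bochner_Integration.integral_cnj[symmetric] by (simp add: mult.commute)

text \<open>
  If \<open>u\<close> were nonzero at \<open>x\<close>, it would be nonzero on a relatively open part of the boundary around
  \<open>x\<close>, small enough to lie in \<open>\<Gamma>\<close> because the boundary of \<open>\<Omega>\<close> is closed. Such a part has positive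
  measure.
\<close>

lemma interface_inner_eq_zero:
  assumes "u \<in> V" "interface_inner u u = 0" "x \<in> \<Gamma>"
  shows "u x = 0"
proof (rule ccontr)
  assume "u x \<noteq> 0"
  let ?f = "\<lambda>x. indicator \<Gamma> x *\<^sub>R (norm (u x))\<^sup>2"
  have eq: "complex_of_real (?f y) = indicator \<Gamma> y *\<^sub>R (u y * cnj (u y))" for y
    using complex_norm_square[of "u y"] by (simp del: of_real_power split: split_indicator)
  have "integrable surface_measure (\<lambda>y. complex_of_real (?f y))"
    unfolding eq using interface_integrable[OF assms(1,1)] unfolding set_integrable_def .
  then have int: "integrable surface_measure ?f" using integrable_Re by fastforce
  have "complex_of_real (LINT y|surface_measure. ?f y) = (LINT y|surface_measure. complex_of_real (?f y))"
    by (rule integral_complex_of_real[symmetric])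
  also have "\<dots> = 0" unfolding eq using assms(2) unfolding interface_inner_def set_lebesgue_integral_def .
  finally have "(LINT y|surface_measure. ?f y) = 0" by simp
  then have ae: "AE y in surface_measure. ?f y = 0"
    by (subst (asm) integral_nonneg_eq_0_iff_AE[OF int]) auto
  have x: "x \<in> frontier S" "x \<in> - frontier \<Omega>" using assms(3) unfolding interface_def by auto
  then have xc: "x \<in> closure S" using frontier_S_sub by blast
  obtain r1 where r1: "r1 > 0" "ball x r1 \<subseteq> - frontier \<Omega>"
    using x(2) open_Compl[OF frontier_closed] open_contains_ball by blast
  have "continuous (at x within closure S) u"
    using FE_local_continuous[OF assms(1)] xc by (simp add: continuous_on_eq_continuous_within)
  then obtain r2 where r2: "r2 > 0" "\<And>y. y \<in> closure S \<Longrightarrow> dist y x < r2 \<Longrightarrow> dist (u y) (u x) < norm (u x)"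
    using \<open>u x \<noteq> 0\<close> unfolding continuous_within_eps_delta by (meson zero_less_norm_iff)
  define r where "r = min r1 r2"
  let ?A = "frontier S \<inter> ball x r"
  have nz: "?f y \<noteq> 0" if y: "y \<in> ?A" for y
  proof -
    have "y \<in> \<Gamma>" using y r1 by (auto simp: interface_def r_def)
    moreover have "u y \<noteq> 0" using r2(2)[of y] y frontier_S_sub by (auto simp: r_def dist_commute)
    ultimately show ?thesis by simp
  qed
  have "AE y in surface_measure. y \<notin> ?A" using ae by eventually_elim (use nz in blast)
  moreover have "?A \<in> sets surface_measure" by (simp add: frontier_closed)
  ultimately have "emeasure surface_measure ?A = 0" by (simp add: AE_iff_null_sets null_setsD1)
  moreover have "emeasure surface_measure ?A > 0"
    using r1 r2 x(1) by (intro surface_measure_frontier_ball_pos sub) (auto simp: r_def)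
  ultimately show False by simp
qed

end

section \<open>Representation of antilinear functionals\<close>

definition fun_subspace :: "('x \<Rightarrow> complex) set \<Rightarrow> bool" where
  "fun_subspace W \<longleftrightarrow> (\<lambda>x. 0) \<in> W \<and> (\<forall>u\<in>W. \<forall>v\<in>W. \<forall>c. (\<lambda>x. u x + c * v x) \<in> W)"

text \<open>
  The form may be degenerate, as the interface inner product is on \<open>V\<close>. The last clause is the part of
  the Cauchy-Schwarz inequality that matters here: a null vector is orthogonal to everything.
\<close>

definition hermitian_on :: "('x \<Rightarrow> complex) set \<Rightarrow> (('x \<Rightarrow> complex) \<Rightarrow> ('x \<Rightarrow> complex) \<Rightarrow> complex) \<Rightarrow> bool" where
  "hermitian_on W B \<longleftrightarrow>
     (\<forall>u\<in>W. \<forall>v\<in>W. \<forall>z\<in>W. \<forall>c. B (\<lambda>x. u x + c * v x) z = B u z + c * B v z) \<and>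
     (\<forall>u\<in>W. \<forall>v\<in>W. B v u = cnj (B u v)) \<and>
     (\<forall>u\<in>W. \<forall>v\<in>W. B v v = 0 \<longrightarrow> B u v = 0)"

definition antilinear_on :: "('x \<Rightarrow> complex) set \<Rightarrow> (('x \<Rightarrow> complex) \<Rightarrow> complex) \<Rightarrow> bool" where
  "antilinear_on W F \<longleftrightarrow> (\<forall>u\<in>W. \<forall>v\<in>W. \<forall>c. F (\<lambda>x. u x + c * v x) = F u + cnj c * F v)"

lemma hermitian_on_antilinear_right:
  assumes "fun_subspace W" "hermitian_on W B" "u \<in> W"
  shows "antilinear_on W (B u)"
  unfolding antilinear_on_def
proof (intro ballI allI)
  fix v z c assume vz: "v \<in> W" "z \<in> W"
  then have m: "(\<lambda>x. v x + c * z x) \<in> W" using assms(1) unfolding fun_subspace_def by blast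
  have sym: "\<And>u v. u \<in> W \<Longrightarrow> v \<in> W \<Longrightarrow> B v u = cnj (B u v)"
    using assms(2) unfolding hermitian_on_def by blast
  have "B u (\<lambda>x. v x + c * z x) = cnj (B (\<lambda>x. v x + c * z x) u)" by (rule sym[OF m assms(3)])
  also have "B (\<lambda>x. v x + c * z x) u = B v u + c * B z u"
    using assms(2,3) vz unfolding hermitian_on_def by blast
  finally show "B u (\<lambda>x. v x + c * z x) = B u v + cnj c * B u z"
    using sym[OF vz(1) assms(3)] sym[OF vz(2) assms(3)] by simp
qed

text \<open>
  Orthogonalisation by induction on the spanning family. If \<open>W'\<close> is the part of \<open>W\<close> that needs only
  the first functions and \<open>f \<in> W\<close> is outside \<open>W'\<close>, then \<open>W = W' + \<complex> f\<close>. By induction the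
  functional \<open>B f\<close> is represented on \<open>W'\<close> by some \<open>q\<close>, which makes \<open>r = f - q\<close> orthogonal to \<open>W'\<close>.
  The representer on \<open>W'\<close> is then corrected by a multiple of \<open>r\<close>, and needs no correction if \<open>r\<close> is
  a null vector. The functions \<open>h i\<close> may lie outside \<open>W\<close>: finite element functions come without a
  basis, only as a subspace of the piecewise polynomials.
\<close>

lemma riesz_representation_finite_span:
  fixes h :: "'i \<Rightarrow> 'x \<Rightarrow> complex"
  assumes "finite I" "fun_subspace W" "hermitian_on W B" "antilinear_on W F"
    and "\<And>v. v \<in> W \<Longrightarrow> \<exists>c. v = (\<lambda>x. \<Sum>i\<in>I. c i * h i x)"
    and "\<And>v. v \<in> W \<Longrightarrow> B v v = 0 \<Longrightarrow> F v = 0"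
  shows "\<exists>g\<in>W. \<forall>v\<in>W. B g v = F v"
  using assms
proof (induction I arbitrary: W F rule: finite_induct)
  case empty
  have z: "(\<lambda>x. 0) \<in> W" using empty.prems(1) unfolding fun_subspace_def by blast
  have only: "v = (\<lambda>x. 0)" if "v \<in> W" for v using empty.prems(4)[OF that] by simp
  have anti0: "G (\<lambda>x. 0) = 0" if "antilinear_on W G" for G
    using that[unfolded antilinear_on_def, rule_format, OF z z, of 1] by simp
  have "B (\<lambda>x. 0) (\<lambda>x. 0) = F (\<lambda>x. 0)"
    using anti0[OF hermitian_on_antilinear_right[OF empty.prems(1,2) z]] anti0[OF empty.prems(3)] by simp
  then have "\<forall>v\<in>W. B (\<lambda>x. 0) v = F v" using only by auto
  then show ?case using z by blast
next
  case (insert i I)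
  note sub = insert.prems(1) and herm = insert.prems(2) and anti = insert.prems(3)
    and span = insert.prems(4) and null = insert.prems(5)
  define W' where "W' = {v\<in>W. \<exists>c. v = (\<lambda>x. \<Sum>i\<in>I. c i * h i x)}"
  have W'W: "W' \<subseteq> W" by (auto simp: W'_def)
  have W'I: "v \<in> W'" if "v \<in> W" "v = (\<lambda>x. \<Sum>i\<in>I. c i * h i x)" for v c
    unfolding W'_def using that by (intro CollectI conjI exI)
  have lin: "(\<lambda>x. u x + c * v x) \<in> W" if "u \<in> W" "v \<in> W" for u v c
    using sub that unfolding fun_subspace_def by blast
  have B_add: "B (\<lambda>x. u x + c * v x) z = B u z + c * B v z" if "u \<in> W" "v \<in> W" "z \<in> W" for u v z c
    using herm that unfolding hermitian_on_def by blast
  have B_sym: "B v u = cnj (B u v)" if "u \<in> W" "v \<in> W" for u v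
    using herm that unfolding hermitian_on_def by blast
  have B_null: "B u v = 0" if "u \<in> W" "v \<in> W" "B v v = 0" for u v
    using herm that unfolding hermitian_on_def by blast
  have B_anti: "B u (\<lambda>x. v x + c * z x) = B u v + cnj c * B u z" if "u \<in> W" "v \<in> W" "z \<in> W" for u v z c
    using hermitian_on_antilinear_right[OF sub herm that(1)] that(2,3) unfolding antilinear_on_def by blast
  have F_anti: "F (\<lambda>x. u x + c * v x) = F u + cnj c * F v" if "u \<in> W" "v \<in> W" for u v c
    using anti that unfolding antilinear_on_def by blast
  have lin': "(\<lambda>x. u x + c * v x) \<in> W'" if uv: "u \<in> W'" "v \<in> W'" for u v c
  proof -
    obtain a b where ab: "u = (\<lambda>x. \<Sum>i\<in>I. a i * h i x)" "v = (\<lambda>x. \<Sum>i\<in>I. b i * h i x)"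
      using uv unfolding W'_def by blast
    have "(\<lambda>x. u x + c * v x) = (\<lambda>x. \<Sum>i\<in>I. (a i + c * b i) * h i x)"
      unfolding ab by (simp add: distrib_right mult.assoc sum.distrib sum_distrib_left)
    moreover have "(\<lambda>x. u x + c * v x) \<in> W" using uv W'W by (intro lin) auto
    ultimately show ?thesis by (rule W'I[rotated])
  qed
  have "(\<lambda>x. 0) \<in> W'"
    using sub unfolding W'_def fun_subspace_def by (auto intro!: exI[of _ "\<lambda>_. 0"])
  then have sub': "fun_subspace W'" using lin' unfolding fun_subspace_def by blast
  have herm': "hermitian_on W' B"
    unfolding hermitian_on_def using W'W B_add B_sym B_null by (meson subsetD)
  have IH: "\<exists>g\<in>W'. \<forall>v\<in>W'. B g v = G v"
    if "antilinear_on W' G" "\<And>v. v \<in> W' \<Longrightarrow> B v v = 0 \<Longrightarrow> G v = 0" for G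
    by (rule insert.IH[OF sub' herm' that(1) _ that(2)]) (auto simp: W'_def)
  have anti': "antilinear_on W' F"
    using anti W'W unfolding antilinear_on_def by blast
  obtain g' where g': "g' \<in> W'" "\<And>v. v \<in> W' \<Longrightarrow> B g' v = F v"
    using IH[OF anti'] null W'W by blast
  have g'W: "g' \<in> W" using g'(1) W'W by blast
  show ?case
  proof (cases "W \<subseteq> W'")
    case True
    then show ?thesis using g' g'W by blast
  next
    case False
    then obtain f where f: "f \<in> W" "f \<notin> W'" by blast
    obtain d where d: "f = (\<lambda>x. \<Sum>j\<in>insert i I. d j * h j x)" using span[OF f(1)] by blast
    have di: "d i \<noteq> 0"
    proof
      assume "d i = 0"
      then have "f = (\<lambda>x. \<Sum>j\<in>I. d j * h j x)" using d insert.hyps by simp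
      with f show False using W'I by blast
    qed
    obtain q where q: "q \<in> W'" "\<And>v. v \<in> W' \<Longrightarrow> B q v = B f v"
    proof -
      have "antilinear_on W' (B f)"
        using B_anti[OF f(1)] W'W unfolding antilinear_on_def by blast
      then show ?thesis using IH[of "B f"] B_null[OF f(1)] W'W that by blast
    qed
    have qW: "q \<in> W" using q(1) W'W by blast
    define r where "r = (\<lambda>x. f x + (- 1) * q x)"
    have rW: "r \<in> W" unfolding r_def by (rule lin[OF f(1) qW])
    have rW': "B r v = 0" if "v \<in> W'" for v
    proof -
      have "v \<in> W" using that W'W by blast
      then have "B r v = B f v + (- 1) * B q v" unfolding r_def by (rule B_add[OF f(1) qW])
      then show ?thesis using q(2)[OF that] by simp
    qed
    have decomp: "\<exists>v'\<in>W'. \<exists>a. v = (\<lambda>x. v' x + a * r x)" if v: "v \<in> W" for v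
    proof -
      obtain e where e: "v = (\<lambda>x. \<Sum>j\<in>insert i I. e j * h j x)" using span[OF v] by blast
      define a where "a = e i / d i"
      define v1 where "v1 = (\<lambda>x. v x + (- a) * f x)"
      have "v1 = (\<lambda>x. \<Sum>j\<in>I. (e j + (- a) * d j) * h j x)"
      proof
        fix x
        have "v1 x = (\<Sum>j\<in>insert i I. (e j + (- a) * d j) * h j x)"
          unfolding v1_def e d by (simp only: distrib_right mult.assoc sum.distrib sum_distrib_left)
        also have "\<dots> = (\<Sum>j\<in>I. (e j + (- a) * d j) * h j x)"
          using insert.hyps di by (simp add: a_def)
        finally show "v1 x = (\<Sum>j\<in>I. (e j + (- a) * d j) * h j x)" .
      qed
      moreover have "v1 \<in> W" unfolding v1_def by (rule lin[OF v f(1)])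
      ultimately have "v1 \<in> W'" by (rule W'I[rotated])
      then have "(\<lambda>x. v1 x + a * q x) \<in> W'" by (rule lin'[OF _ q(1)])
      moreover have "v = (\<lambda>x. (\<lambda>x. v1 x + a * q x) x + a * r x)"
        by (simp add: v1_def r_def algebra_simps)
      ultimately show ?thesis by (intro bexI[of _ "\<lambda>x. v1 x + a * q x"] exI[of _ a])
    qed
    have g'r: "B g' r = 0" using B_sym[OF rW g'W] rW'[OF g'(1)] by simp
    define t where "t = F r / B r r"
    have tr: "t * B r r = F r"
      using null[OF rW] by (cases "B r r = 0") (simp_all add: t_def)
    define g where "g = (\<lambda>x. g' x + t * r x)"
    have gW: "g \<in> W" unfolding g_def by (rule lin[OF g'W rW])
    have "B g v = F v" if v: "v \<in> W" for v
    proof -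
      obtain v' a where v': "v' \<in> W'" and va: "v = (\<lambda>x. v' x + a * r x)" using decomp[OF v] by blast
      have v'W: "v' \<in> W" using v' W'W by blast
      have "B g v = B g v' + cnj a * B g r" unfolding va by (rule B_anti[OF gW v'W rW])
      also have "B g v' = F v'" unfolding g_def B_add[OF g'W rW v'W] by (simp add: g'(2) rW' v')
      also have "B g r = F r" unfolding g_def B_add[OF g'W rW rW] by (simp add: g'r tr)
      also have "F v' + cnj a * F r = F v" unfolding va by (rule F_anti[OF v'W rW, symmetric])
      finally show ?thesis .
    qed
    then show ?thesis using gW by blast
  qed
qed

section \<open>The discrete impedance trace\<close>

context fe_subdomain
begin

text \<open>
  The monomials cut off to single elements span a space containing \<open>V\<close>. Elements overlap in their faces, so each point
  is assigned to one element \<open>\<kappa> x\<close> that contains it, lest values be counted twice.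
\<close>

lemma FE_local_finite_span:
  "\<exists>(I :: ('a set \<times> ('a \<Rightarrow> nat)) set) h. finite I \<and> (\<forall>v\<in>V. \<exists>c. v = (\<lambda>x. \<Sum>i\<in>I. c i * h i x))"
proof -
  note m = conforming_simplicial_mesh_elements[OF mesh]
  let ?A = "{\<alpha> \<in> Basis \<rightarrow>\<^sub>E {..p}. (\<Sum>b\<in>Basis. \<alpha> b) \<le> p} :: ('a \<Rightarrow> nat) set"
  let ?m = "\<lambda>\<alpha> x. complex_of_real (\<Prod>b\<in>Basis. (x \<bullet> b) ^ \<alpha> b)"
  define \<kappa> where "\<kappa> x = (SOME K. K \<in> T \<and> x \<in> K)" for x
  define h where "h = (\<lambda>(K, \<alpha>) x. if x \<in> closure S \<and> \<kappa> x = K then ?m \<alpha> x else 0)"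
  have finA: "finite ?A" by (rule finite_subset[of _ "Basis \<rightarrow>\<^sub>E {..p}"]) (auto intro: finite_PiE)
  have "\<exists>c. v = (\<lambda>x. \<Sum>i\<in>T \<times> ?A. c i * h i x)" if v: "v \<in> V" for v
  proof -
    obtain v0 where v0: "v0 \<in> FE_space \<Omega> T p" and vr: "v = restrict_zero (closure S) v0"
      using v unfolding FE_local_def by blast
    have "\<exists>d. \<forall>x\<in>K. v0 x = (\<Sum>\<alpha>\<in>?A. d \<alpha> * ?m \<alpha> x)" if K: "K \<in> T" for K
    proof -
      obtain P where P: "poly_total_degree_le p P" "\<forall>x\<in>K. v0 x = P x"
        using v0 K unfolding FE_space_def by blast
      obtain d where "\<forall>x. P x = (\<Sum>\<alpha>\<in>?A. d \<alpha> * ?m \<alpha> x)"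
        using P(1) unfolding poly_total_degree_le_def by (elim exE)
      then show ?thesis using P(2) by (intro exI[of _ d]) simp
    qed
    then have "\<forall>K\<in>T. \<exists>d. \<forall>x\<in>K. v0 x = (\<Sum>\<alpha>\<in>?A. d \<alpha> * ?m \<alpha> x)" by blast
    from bchoice[OF this] obtain d where d: "\<forall>K\<in>T. \<forall>x\<in>K. v0 x = (\<Sum>\<alpha>\<in>?A. d K \<alpha> * ?m \<alpha> x)" by blast
    have "v x = (\<Sum>i\<in>T \<times> ?A. (case i of (K, \<alpha>) \<Rightarrow> d K \<alpha>) * h i x)" for x
    proof (cases "x \<in> closure S")
      case False
      then show ?thesis by (simp add: vr restrict_zero_def h_def split_def)
    next
      case True
      then have "x \<in> \<Union>T" using closure_S_sub m(4) by blast
      then have \<kappa>: "\<kappa> x \<in> T" "x \<in> \<kappa> x"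
        unfolding \<kappa>_def using someI_ex[of "\<lambda>K. K \<in> T \<and> x \<in> K"] by blast+
      have "(\<Sum>i\<in>T \<times> ?A. (case i of (K, \<alpha>) \<Rightarrow> d K \<alpha>) * h i x)
          = (\<Sum>K\<in>T. \<Sum>\<alpha>\<in>?A. d K \<alpha> * h (K, \<alpha>) x)"
        by (subst sum.cartesian_product) (simp add: split_def)
      also have "\<dots> = (\<Sum>K\<in>T. if \<kappa> x = K then \<Sum>\<alpha>\<in>?A. d K \<alpha> * ?m \<alpha> x else 0)"
        using True by (intro sum.cong) (auto simp: h_def)
      also have "\<dots> = v0 x" using \<kappa> d m(1) by simp
      finally show ?thesis using True by (simp add: vr restrict_zero_def)
    qed
    then show ?thesis by (intro exI[of _ "\<lambda>i. case i of (K, \<alpha>) \<Rightarrow> d K \<alpha>"] ext)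
  qed
  moreover have "finite (T \<times> ?A)" using m(1) finA by (rule finite_cartesian_product)
  ultimately show ?thesis by blast
qed

lemma FE_local_subspace: "fun_subspace V"
proof -
  have "poly_total_degree_le p (\<lambda>x. 0)"
    unfolding poly_total_degree_le_def by (intro exI[of _ "\<lambda>_. 0"]) simp
  then have "(\<lambda>x. 0) \<in> FE_space \<Omega> T p" unfolding FE_space_def by auto
  moreover have "(\<lambda>x. 0) = restrict_zero (closure S) (\<lambda>x. 0)" by (simp add: restrict_zero_def)
  ultimately have "(\<lambda>x. 0) \<in> V" unfolding FE_local_def by blast
  then show ?thesis unfolding fun_subspace_def using FE_local_lincomb by blast
qed

lemma interface_inner_hermitian: "hermitian_on V interface_inner"
  unfolding hermitian_on_def
proof (intro conjI ballI allI impI)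
  fix u v assume "u \<in> V" "v \<in> V" "interface_inner v v = 0"
  then have "v x = 0" if "x \<in> \<Gamma>" for x using interface_inner_eq_zero that by blast
  then have zero: "indicator \<Gamma> x *\<^sub>R (u x * cnj (v x)) = 0" for x by (cases "x \<in> \<Gamma>") auto
  show "interface_inner u v = 0" unfolding interface_inner_def set_lebesgue_integral_def zero by simp
qed (simp_all add: interface_inner_add_left interface_inner_sym[symmetric])

lemma interface_representation_exists:
  assumes w: "w \<in> discrete_harmonic \<Omega> T p k S"
  shows "\<exists>g\<in>V. \<forall>v\<in>V. interface_inner g v = helmholtz_form S k w v"
proof -
  obtain I :: "('a set \<times> ('a \<Rightarrow> nat)) set" and h where I: "finite I" "\<And>v. v \<in> V \<Longrightarrow> \<exists>c. v = (\<lambda>x. \<Sum>i\<in>I. c i * h i x)"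
    using FE_local_finite_span by blast
  have wV: "w \<in> V" using w unfolding discrete_harmonic_def by blast
  show ?thesis
  proof (rule riesz_representation_finite_span[OF I(1) FE_local_subspace interface_inner_hermitian _ I(2)])
    show "antilinear_on V (helmholtz_form S k w)"
      unfolding antilinear_on_def using helmholtz_form_antilinear[OF wV] by blast
    show "helmholtz_form S k w v = 0" if "v \<in> V" "interface_inner v v = 0" for v
      by (rule discrete_harmonic_vanishes[OF w that(1)]) (rule interface_inner_eq_zero[OF that])
  qed
qed

lemma interface_inner_restrict:
  "(LINT x:\<Gamma>|surface_measure. restrict_zero \<Gamma> u x * cnj (v x)) = interface_inner u v"
  unfolding interface_inner_def set_lebesgue_integral_def
  by (intro Bochner_Integration.integral_cong) (auto simp: restrict_zero_def split: split_indicator)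

lemma FE_interface_eq: "FE_interface \<Omega> T p S = restrict_zero \<Gamma> ` V"
proof -
  have "restrict_zero \<Gamma> (restrict_zero (closure S) v) = restrict_zero \<Gamma> v" for v
    using interface_sub frontier_S_sub by (auto simp: restrict_zero_def fun_eq_iff)
  then show ?thesis unfolding FE_interface_def FE_local_def image_image by simp
qed

lemma interface_inner_cancel:
  assumes "u \<in> V" "u' \<in> V" and eq: "\<And>v. v \<in> V \<Longrightarrow> interface_inner u v = interface_inner u' v"
  shows "restrict_zero \<Gamma> u = restrict_zero \<Gamma> u'"
proof -
  define d where "d = (\<lambda>x. u x + (- 1) * u' x)"
  have d: "d \<in> V" unfolding d_def by (rule FE_local_lincomb[OF assms(1,2)])
  have "interface_inner d d = interface_inner u d + (- 1) * interface_inner u' d"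
    by (subst (1) d_def) (rule interface_inner_add_left[OF assms(1,2) d])
  then have "interface_inner d d = 0" using eq[OF d] by simp
  then have "d x = 0" if "x \<in> \<Gamma>" for x using interface_inner_eq_zero[OF d] that by blast
  then show ?thesis by (auto simp: restrict_zero_def d_def fun_eq_iff)
qed

end

theorem lemma3p4:
  fixes \<Omega> :: "'a::euclidean_space set"
    and T :: "'a set set"
    and \<Omega>s :: "nat \<Rightarrow> 'a set"
    and N p l :: nat
    and k :: real
    and w :: "'a \<Rightarrow> complex"
  assumes "DIM('a) = 2 \<or> DIM('a) = 3"
    and "k > 0"
    and "lipschitz_polyhedral_domain \<Omega>"
    and "conforming_simplicial_mesh T \<Omega>"
    and "\<And>j. j \<in> {1..N} \<Longrightarrow> lipschitz_polyhedral_domain (\<Omega>s j)"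
    and "\<And>j. j \<in> {1..N} \<Longrightarrow> boundary_resolved_by (\<Omega>s j) T"
    and "(\<Union>j\<in>{1..N}. \<Omega>s j) = \<Omega>"
    and "l \<in> {1..N}"
    and "w \<in> discrete_harmonic \<Omega> T p k (\<Omega>s l)"
  shows "\<exists>!g. g \<in> FE_interface \<Omega> T p (\<Omega>s l) \<and>
           (\<forall>v \<in> FE_local \<Omega> T p (\<Omega>s l).
              (LINT x:interface \<Omega> (\<Omega>s l)|surface_measure. g x * cnj (v x))
              = helmholtz_form (\<Omega>s l) k w v)"
proof -
  interpret fe_subdomain \<Omega> "\<Omega>s l" T p
    using assms by unfold_locales auto
  obtain u where u: "u \<in> V" "\<And>v. v \<in> V \<Longrightarrow> interface_inner u v = helmholtz_form (\<Omega>s l) k w v"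
    using interface_representation_exists[OF assms(9)] by blast
  show ?thesis
  proof (intro ex1I[of _ "restrict_zero \<Gamma> u"] conjI ballI)
    show "restrict_zero \<Gamma> u \<in> FE_interface \<Omega> T p (\<Omega>s l)"
      unfolding FE_interface_eq using u(1) by blast
    show "(LINT x:\<Gamma>|surface_measure. restrict_zero \<Gamma> u x * cnj (v x)) = helmholtz_form (\<Omega>s l) k w v" if "v \<in> V" for v
      unfolding interface_inner_restrict by (rule u(2)[OF that])
    fix g assume g: "g \<in> FE_interface \<Omega> T p (\<Omega>s l) \<and>
      (\<forall>v\<in>V. (LINT x:\<Gamma>|surface_measure. g x * cnj (v x)) = helmholtz_form (\<Omega>s l) k w v)"
    then obtain u' where u': "u' \<in> V" "g = restrict_zero \<Gamma> u'" unfolding FE_interface_eq by blast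
    have "interface_inner u' v = interface_inner u v" if "v \<in> V" for v
      using g u(2)[OF that] that unfolding u'(2) interface_inner_restrict by simp
    then show "g = restrict_zero \<Gamma> u" unfolding u'(2) by (rule interface_inner_cancel[OF u'(1) u(1)])
  qed
qed

end
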